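(* Let $n\ge 1$, let $\Omega\subset\mathbb{R}^n$ be open and bounded, $s\in(0,1)$, let $G$ be a Young function satisfying $(G_1)$, $(G_2)$, $(G_3)$, and let $\alpha>0$. Let $M_\alpha^D=\{u\in W^{s,G}_0(\Omega):\mathcal{I}(u)=\alpha\}$ and, for $k\in\mathbb{N}$, $$C_{k,\alpha}^D=\inf_{h\in\Gamma(S^{k-1},M_\alpha^D)}\sup_{w\in S^{k-1}}\mathcal{J}(h(w)),$$ and let $\{\Lambda_{k,\alpha}^D\}_{k\in\mathbb{N}}$ be the sequence of minimax eigenvalues of the Dirichlet problem $D(\Omega)$, i.e. each $\Lambda_{k,\alpha}^D$ is an eigenvalue of $D(\Omega)$ with an eigenfunction $u_{k,\alpha}^D\in W_0^{s,G}(\Omega)$ satisfying $\mathcal{I}(u_{k,\alpha}^D)=\alpha$ and $\mathcal{J}(u_{k,\alpha}^D)=C_{k,\alpha}^D$. Then $$\Lambda_{k,\alpha}^D\to\infty\quad\text{and}\quad C_{k,\alpha}^D\to\infty\qquad\text{as }k\to\infty.$$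
   Context: Young function: $G(t)=\int_0^t g(\tau)\,d\tau$ for $t\ge0$, where $g:[0,\infty)\to[0,\infty)$ is right continuous, $g(0)=0$, $g(t)>0$ for $t>0$, $g$ is non-decreasing on $(0,\infty)$, and $\lim_{t\to\infty}g(t)=\infty$. Structural conditions: $(G_1)$ there are constants $p^-,p^+$ with $1<p^-\le \frac{tg(t)}{G(t)}\le p^+<\infty$ for all $t>0$; $(G_2)$ $t\mapsto G(\sqrt t)$, $t\in[0,\infty)$, is convex; $(G_3)$ $\int_0^1 \frac{G^{-1}(\tau)}{\tau^{(n+s)/n}}\,d\tau<\infty$ and $\int_1^{\infty}\frac{G^{-1}(\tau)}{\tau^{(n+s)/n}}\,d\tau=\infty$. Notation: $D_su(x,y)=\frac{u(x)-u(y)}{|x-y|^s}$, $d\mu=\frac{dx\,dy}{|x-y|^n}$; $g(|t|)\frac{t}{|t|}$ is read as $0$ at $t=0$. Functionals: $\mathcal{I}(u)=\int_\Omega G(|u|)\,dx$, $\mathcal{J}(u)=\iint_{\mathbb{R}^n\times\mathbb{R}^n}G(|D_su|)\,d\mu$. Space: $W^{s,G}_0(\Omega)=\{u:\mathbb{R}^n\to\mathbb{R}\text{ measurable}: \int_{\mathbb{R}^n}G(|u|)\,dx<\infty,\ \mathcal{J}(u)<\infty,\ u=0\text{ a.e. in }\mathbb{R}^n\setminus\Omega\}$, normed by $\|u\|_{L^G(\Omega)}+[u]_{W^{s,G}(\mathbb{R}^n)}$, where $\|u\|_{L^G(\Omega)}=\inf\{\lambda>0:\mathcal{I}(u/\lambda)\le1\}$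 and $[u]_{W^{s,G}(\mathbb{R}^n)}=\inf\{\lambda>0:\mathcal{J}(u/\lambda)\le1\}$. $\lambda\in\mathbb{R}$ is an eigenvalue of the Dirichlet problem $D(\Omega)$ with eigenfunction $u\in W^{s,G}_0(\Omega)$, $u\ne0$, if $$\iint_{\mathbb{R}^n\times\mathbb{R}^n}g(|D_su|)\frac{D_su}{|D_su|}D_sv\,d\mu=\lambda\int_\Omega g(|u|)\frac{u}{|u|}v\,dx\qquad\forall v\in W^{s,G}_0(\Omega).$$ $S^{k-1}$ is the unit sphere of $\mathbb{R}^k$; $\Gamma(S^{k-1},M_\alpha^D)$ is the set of odd continuous maps $h:S^{k-1}\to M_\alpha^D$ (norm topology). *)

theory Defs
  imports "HOL-Analysis.Analysis"
begin

definition young_primitive :: "(real \<Rightarrow> real) \<Rightarrow> real \<Rightarrow> real" where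
  "young_primitive g t = integral {0..t} g"

(* Only the values of g and of its primitive on [0, \<infinity>) matter. *)
definition young_density :: "(real \<Rightarrow> real) \<Rightarrow> bool" where
  "young_density g \<longleftrightarrow>
     (\<forall>t\<ge>0. continuous (at_right t) g) \<and>
     g 0 = 0 \<and>
     (\<forall>t>0. g t > 0) \<and>
     mono_on {0<..} g \<and>
     filterlim g at_top at_top"

definition cond_G1 :: "(real \<Rightarrow> real) \<Rightarrow> bool" where
  "cond_G1 g \<longleftrightarrow>
     (\<exists>p_minus p_plus. 1 < p_minus \<and>
        (\<forall>t>0. p_minus \<le> t * g t / young_primitive g t \<and>
               t * g t / young_primitive g t \<le> p_plus))"

definition cond_G2 :: "(real \<Rightarrow> real) \<Rightarrow> bool" where
  "cond_G2 g \<longleftrightarrow> convex_on {0..} (\<lambda>t. young_primitive g (sqrt t))"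

definition cond_G3 :: "nat \<Rightarrow> real \<Rightarrow> (real \<Rightarrow> real) \<Rightarrow> bool" where
  "cond_G3 n s g \<longleftrightarrow>
     (let Ginv = inv_into {0..} (young_primitive g);
          f = (\<lambda>\<tau>. ennreal (Ginv \<tau> / \<tau> powr ((real n + s) / real n)))
      in (\<integral>\<^sup>+\<tau>\<in>{0..1}. f \<tau> \<partial>lborel) < \<infinity> \<and>
         (\<integral>\<^sup>+\<tau>\<in>{1..}. f \<tau> \<partial>lborel) = \<infinity>)"

definition Ds :: "real \<Rightarrow> ('a::euclidean_space \<Rightarrow> real) \<Rightarrow> 'a \<times> 'a \<Rightarrow> real" where
  "Ds s u = (\<lambda>(x, y). (u x - u y) / norm (x - y) powr s)"

(* The measure dx dy / |x - y|^n on R^n x R^n; the diagonal, where division by zero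
   gives density 0, is a null set. *)
definition mu :: "('a::euclidean_space \<times> 'a) measure" where
  "mu = density lebesgue (\<lambda>(x, y). ennreal (1 / norm (x - y) ^ DIM('a)))"

definition modular_I ::
  "(real \<Rightarrow> real) \<Rightarrow> 'a::euclidean_space set \<Rightarrow> ('a \<Rightarrow> real) \<Rightarrow> ennreal" where
  "modular_I g \<Omega> u = (\<integral>\<^sup>+x\<in>\<Omega>. ennreal (young_primitive g \<bar>u x\<bar>) \<partial>lebesgue)"

definition modular_J ::
  "(real \<Rightarrow> real) \<Rightarrow> real \<Rightarrow> ('a::euclidean_space \<Rightarrow> real) \<Rightarrow> ennreal" where
  "modular_J g s u = (\<integral>\<^sup>+z. ennreal (young_primitive g \<bar>Ds s u z\<bar>) \<partial>mu)"

(* Elements are functions, not equivalence classes; equality of elements of the space is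
   therefore rendered below as equality almost everywhere. *)
definition W0 ::
  "(real \<Rightarrow> real) \<Rightarrow> real \<Rightarrow> 'a::euclidean_space set \<Rightarrow> ('a \<Rightarrow> real) set" where
  "W0 g s \<Omega> =
     {u \<in> borel_measurable lebesgue.
        modular_I g UNIV u < \<infinity> \<and>
        modular_J g s u < \<infinity> \<and>
        (AE x in lebesgue. x \<notin> \<Omega> \<longrightarrow> u x = 0)}"

definition W0_norm ::
  "(real \<Rightarrow> real) \<Rightarrow> real \<Rightarrow> 'a::euclidean_space set \<Rightarrow> ('a \<Rightarrow> real) \<Rightarrow> real" where
  "W0_norm g s \<Omega> u =
     Inf {c. c > 0 \<and> modular_I g \<Omega> (\<lambda>x. u x / c) \<le> 1} +
     Inf {c. c > 0 \<and> modular_J g s (\<lambda>x. u x / c) \<le> 1}"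

definition M_D ::
  "(real \<Rightarrow> real) \<Rightarrow> real \<Rightarrow> 'a::euclidean_space set \<Rightarrow> real \<Rightarrow> ('a \<Rightarrow> real) set" where
  "M_D g s \<Omega> \<alpha> = {u \<in> W0 g s \<Omega>. modular_I g \<Omega> u = ennreal \<alpha>}"

(* S^(k-1) for k \<ge> 1: nsphere (k - 1) is the unit sphere of R^k, with points of R^k encoded
   as functions nat \<Rightarrow> real vanishing at all indices \<ge> k. *)
abbreviation sphere_Rk :: "nat \<Rightarrow> (nat \<Rightarrow> real) topology" where
  "sphere_Rk k \<equiv> nsphere (k - 1)"

definition odd_maps ::
  "(real \<Rightarrow> real) \<Rightarrow> real \<Rightarrow> 'a::euclidean_space set \<Rightarrow> real \<Rightarrow> nat
     \<Rightarrow> ((nat \<Rightarrow> real) \<Rightarrow> 'a \<Rightarrow> real) set" where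
  "odd_maps g s \<Omega> \<alpha> k =
     {h. (\<forall>w\<in>topspace (sphere_Rk k). h w \<in> M_D g s \<Omega> \<alpha>) \<and>
         (\<forall>w\<in>topspace (sphere_Rk k). AE x in lebesgue. h (\<lambda>i. - w i) x = - h w x) \<and>
         (\<forall>w\<in>topspace (sphere_Rk k).
            ((\<lambda>w'. W0_norm g s \<Omega> (\<lambda>x. h w' x - h w x)) \<longlongrightarrow> 0) (atin (sphere_Rk k) w))}"

definition C_D ::
  "(real \<Rightarrow> real) \<Rightarrow> real \<Rightarrow> 'a::euclidean_space set \<Rightarrow> real \<Rightarrow> nat \<Rightarrow> ennreal" where
  "C_D g s \<Omega> \<alpha> k =
     (INF h\<in>odd_maps g s \<Omega> \<alpha> k. SUP w\<in>topspace (sphere_Rk k). modular_J g s (h w))"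

(* At t = 0 the quotient t / |t| is 0 by division by zero, as required. *)
definition signed_g :: "(real \<Rightarrow> real) \<Rightarrow> real \<Rightarrow> real" where
  "signed_g g t = g \<bar>t\<bar> * (t / \<bar>t\<bar>)"

definition dirichlet_eigenpair ::
  "(real \<Rightarrow> real) \<Rightarrow> real \<Rightarrow> 'a::euclidean_space set \<Rightarrow> real \<Rightarrow> ('a \<Rightarrow> real) \<Rightarrow> bool" where
  "dirichlet_eigenpair g s \<Omega> lam u \<longleftrightarrow>
     u \<in> W0 g s \<Omega> \<and>
     \<not> (AE x in lebesgue. u x = 0) \<and>
     (\<forall>v\<in>W0 g s \<Omega>.
        (LINT z|mu. signed_g g (Ds s u z) * Ds s v z) =
        lam * (LINT x:\<Omega>|lebesgue. signed_g g (u x) * v x))"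

definition minimax_eigenvalues ::
  "(real \<Rightarrow> real) \<Rightarrow> real \<Rightarrow> 'a::euclidean_space set \<Rightarrow> real \<Rightarrow> (nat \<Rightarrow> real) \<Rightarrow> bool" where
  "minimax_eigenvalues g s \<Omega> \<alpha> \<Lambda> \<longleftrightarrow>
     (\<forall>k\<ge>1. \<exists>u. dirichlet_eigenpair g s \<Omega> (\<Lambda> k) u \<and>
        modular_I g \<Omega> u = ennreal \<alpha> \<and>
        modular_J g s u = C_D g s \<Omega> \<alpha> k)"

end

theory Submission
  imports Defs "HOL-Homology.Invariance_of_Domain"
begin

text \<open>
  Cut \<open>\<real>\<^sup>n\<close> into cubes of side \<open>1 / N\<close>. If all means of \<open>u\<close> over the cubes that meet \<open>\<Omega>\<close> vanish,
  then convexity of the Young function \<open>G\<close> bounds the integral of \<open>G(\<bar>u x\<bar>)\<close> over a cube by the average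
  of \<open>G(\<bar>u x - u y\<bar>)\<close> over pairs of its points, and hence \<open>\<I>(u)\<close> by \<open>C N\<^sup>-\<^sup>s \<J>(u)\<close>. The vector of the \<open>m\<close> cube means is
  an odd continuous function of \<open>u\<close>, so by the Borsuk--Ulam theorem every odd map from a sphere of
  dimension at least \<open>m\<close> into the level set \<open>\<I> = \<alpha>\<close> passes through such a \<open>u\<close>, where
  \<open>\<J>(u) \<ge> \<alpha> N\<^sup>s / C\<close>. Thus \<open>C\<^sub>k\<close> tends to infinity, without any compact embedding. Testing the
  eigenvalue equation with \<open>v = u\<close> and using \<open>G\<^sub>1\<close> bounds the eigenvalue from below by a
  constant times \<open>C\<^sub>k\<close>.

  Borsuk--Ulam follows from the oddness of the degree of odd self-maps of spheres. In the
  induction on the dimension, an odd Lipschitz approximation of the map restricted to the equator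
  misses a pair of antipodal directions, along which the map is pushed to one that preserves the
  equator.
\<close>

section \<open>Odd maps of spheres\<close>

text \<open>Points of R^(n+1) are sequences vanishing above index n, the encoding used by
  \<open>nsphere\<close>; thus \<open>sph n\<close> is literally the equator of
  \<open>sph (Suc n)\<close>, as the induction on the dimension requires.\<close>

definition sph :: "nat \<Rightarrow> (nat \<Rightarrow> real) set" where
  "sph n = {x. (\<Sum>i\<le>n. (x i)\<^sup>2) = 1 \<and> (\<forall>i>n. x i = 0)}"

text \<open>Radial projection of the first n + 1 coordinates to the sphere. Where they all vanish,
  division by zero gives 0, so landing on the sphere requires non-vanishing.\<close>

definition unit_vec :: "nat \<Rightarrow> (nat \<Rightarrow> real) \<Rightarrow> nat \<Rightarrow> real" where
  "unit_vec n y = (\<lambda>i. if i \<le> n then y i / L2_set y {..n} else 0)"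

lemma nsphere_eq_top_of_set: "nsphere n = top_of_set (sph n)"
  by (simp add: nsphere sph_def euclidean_product_topology)

lemma topspace_nsphere_eq_sph: "topspace (nsphere n) = sph n"
  by (simp add: nsphere_eq_top_of_set)

lemma sph_sum: "x \<in> sph n \<Longrightarrow> (\<Sum>i\<le>n. (x i)\<^sup>2) = 1"
  and sph_above: "x \<in> sph n \<Longrightarrow> n < i \<Longrightarrow> x i = 0"
  by (auto simp: sph_def)

lemma sph_minus: "x \<in> sph n \<Longrightarrow> (\<lambda>i. - x i) \<in> sph n"
  by (simp add: sph_def)

lemma sph_abs_le: "x \<in> sph n \<Longrightarrow> \<bar>x i\<bar> \<le> 1"
proof (cases "i \<le> n")
  case True
  assume x: "x \<in> sph n"
  have "(x i)\<^sup>2 \<le> (\<Sum>i\<le>n. (x i)\<^sup>2)"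
    using True by (intro member_le_sum) auto
  with sph_sum[OF x] show ?thesis
    by (simp add: abs_square_le_1)
qed (simp add: sph_above)

lemma sph_Suc_iff: "x \<in> sph n \<longleftrightarrow> x \<in> sph (Suc n) \<and> x (Suc n) = 0"
proof -
  have "(\<forall>i>n. x i = 0) \<longleftrightarrow> (\<forall>i>Suc n. x i = 0) \<and> x (Suc n) = 0"
    by (metis Suc_lessI less_SucI lessI not_less_eq)
  then show ?thesis
    by (auto simp: sph_def)
qed

text \<open>Otherwise, as the square of a coordinate is at most its absolute value, the n + 1
  squares would sum to less than 1.\<close>

lemma sph_coordinate_ge:
  assumes "x \<in> sph n"
  obtains i where "i \<le> n" "\<bar>x i\<bar> \<ge> 1 / (real n + 1)"
proof -
  have "\<exists>i\<le>n. \<bar>x i\<bar> \<ge> 1 / (real n + 1)"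
  proof (rule ccontr)
    assume "\<not> ?thesis"
    then have small: "\<bar>x i\<bar> < 1 / (real n + 1)" if "i \<le> n" for i
      using that by force
    have "(\<Sum>i\<le>n. (x i)\<^sup>2) < (\<Sum>i\<le>n. 1 / (real n + 1))"
    proof (rule sum_strict_mono)
      fix i assume "i \<in> {..n}"
      then have "\<bar>x i\<bar> * \<bar>x i\<bar> \<le> 1 * \<bar>x i\<bar>"
        by (intro mult_right_mono sph_abs_le[OF assms]) auto
      then show "(x i)\<^sup>2 < 1 / (real n + 1)"
        using small[of i] \<open>i \<in> {..n}\<close> by (simp add: power2_eq_square)
    qed auto
    then show False
      using sph_sum[OF assms] by (simp add: add_ac)
  qed
  then show ?thesis
    using that by blast
qed

lemma L2_set_sph: "x \<in> sph n \<Longrightarrow> L2_set x {..n} = 1"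
  by (simp add: L2_set_def sph_sum)

lemma unit_vec_sph: "x \<in> sph n \<Longrightarrow> unit_vec n x = x"
  by (auto simp: unit_vec_def L2_set_sph sph_above)

lemma unit_vec_in_sph:
  assumes "L2_set y {..n} \<noteq> 0"
  shows "unit_vec n y \<in> sph n"
proof -
  have "(\<Sum>i\<le>n. (y i)\<^sup>2) = (L2_set y {..n})\<^sup>2"
    by (simp add: L2_set_def sum_nonneg)
  then show ?thesis
    using assms by (simp add: sph_def unit_vec_def power_divide flip: sum_divide_distrib)
qed

lemma unit_vec_minus: "unit_vec n (\<lambda>i. - y i) = (\<lambda>i. - unit_vec n y i)"
  by (auto simp: unit_vec_def L2_set_def)

lemma L2_set_ne_0I: "finite A \<Longrightarrow> i \<in> A \<Longrightarrow> y i \<noteq> 0 \<Longrightarrow> L2_set y A \<noteq> 0"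
  by (auto simp: L2_set_eq_0_iff)

lemma continuous_on_unit_vec:
  assumes "\<And>i. i \<le> n \<Longrightarrow> continuous_on S (\<lambda>x. f x i)"
    and "\<And>x. x \<in> S \<Longrightarrow> L2_set (f x) {..n} \<noteq> 0"
  shows "continuous_on S (\<lambda>x. unit_vec n (f x))"
proof (rule continuous_on_coordinatewise_then_product)
  fix i
  have "continuous_on S (\<lambda>x. L2_set (f x) {..n})"
    unfolding L2_set_def by (intro continuous_intros assms) auto
  then show "continuous_on S (\<lambda>x. unit_vec n (f x) i)"
    using assms by (cases "i \<le> n") (auto simp: unit_vec_def intro!: continuous_intros)
qed

lemma continuous_map_nsphere_iff:
  "continuous_map (nsphere n) (nsphere m) f \<longleftrightarrow> continuous_on (sph n) f \<and> f ` sph n \<subseteq> sph m"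
  by (simp add: nsphere_eq_top_of_set image_subset_iff_funcset)

text \<open>A homotopy in R^(n+1) that avoids the origin becomes, after radial projection, a
  homotopy of self-maps of the sphere. This makes straight-line deformations available for
  degrees.\<close>

lemma Brouwer_degree2_unit_vec_homotopy:
  assumes cont: "\<And>i. i \<le> n \<Longrightarrow> continuous_on ({0..1} \<times> sph n) (\<lambda>z. h (fst z) (snd z) i)"
    and nz: "\<And>t x. 0 \<le> t \<Longrightarrow> t \<le> 1 \<Longrightarrow> x \<in> sph n \<Longrightarrow> \<exists>i\<le>n. h t x i \<noteq> 0"
  shows "Brouwer_degree2 n (\<lambda>x. unit_vec n (h 0 x)) = Brouwer_degree2 n (\<lambda>x. unit_vec n (h (1::real) x))"
proof (rule Brouwer_degree2_homotopic)
  have ne: "L2_set (h t x) {..n} \<noteq> 0" if "0 \<le> t" "t \<le> 1" "x \<in> sph n" for t x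
    using nz[OF that] by (auto simp: L2_set_eq_0_iff)
  have "continuous_on ({0..1} \<times> sph n) (\<lambda>z. unit_vec n (h (fst z) (snd z)))"
    by (intro continuous_on_unit_vec cont) (auto simp: ne)
  then have "continuous_map (prod_topology (top_of_set {0..1}) (nsphere n)) (nsphere n)
      (\<lambda>z. unit_vec n (h (fst z) (snd z)))"
    by (auto simp: nsphere_eq_top_of_set ne intro!: unit_vec_in_sph simp flip: subtopology_Times)
  then show "homotopic_with (\<lambda>x. True) (nsphere n) (nsphere n)
      (\<lambda>x. unit_vec n (h 0 x)) (\<lambda>x. unit_vec n (h 1 x))"
    unfolding homotopic_with_def by (intro exI conjI) auto
qed

text \<open>The sphere is a closed subset of a product of compact intervals, so Tychonoff's theorem
  applies.\<close>

lemma compact_sph: "compact (sph n)"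
proof -
  have "sph n = (Pi\<^sub>E UNIV (\<lambda>i. if i \<le> n then {-1..1} else {0})) \<inter> {x. (\<Sum>i\<le>n. (x i)\<^sup>2) = 1}"
    (is "_ = ?K \<inter> ?E")
  proof (intro Set.set_eqI iffI)
    fix x assume "x \<in> sph n"
    then show "x \<in> ?K \<inter> ?E"
      using sph_abs_le[of x n] sph_sum[of x n] by (auto simp: sph_above abs_le_iff minus_le_iff)
  next
    fix x assume x: "x \<in> ?K \<inter> ?E"
    have "x i = 0" if "n < i" for i
      using PiE_mem[OF IntD1[OF x], of i] that by simp
    with x show "x \<in> sph n"
      by (simp add: sph_def)
  qed
  moreover have "compactin (powertop_real UNIV) ?K"
    by (subst compactin_PiE) auto
  then have "compact ?K"
    by (simp add: euclidean_product_topology)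
  moreover have "closed ?E"
    by (intro closed_Collect_eq continuous_intros continuous_on_product_coordinates)
  ultimately show ?thesis
    by (simp add: compact_Int_closed)
qed

section \<open>Lipschitz functions on the sphere\<close>

definition sph_lipschitz :: "nat \<Rightarrow> ((nat \<Rightarrow> real) \<Rightarrow> real) \<Rightarrow> bool" where
  "sph_lipschitz n f \<longleftrightarrow> (\<exists>L\<ge>0. \<forall>x\<in>sph n. \<forall>y\<in>sph n. \<bar>f x - f y\<bar> \<le> L * L2_set (\<lambda>i. x i - y i) {..n})"

lemma sph_lipschitz_continuous:
  assumes "sph_lipschitz n f"
  shows "continuous_on (sph n) f"
proof -
  obtain L where L: "L \<ge> 0"
    "\<And>x y. x \<in> sph n \<Longrightarrow> y \<in> sph n \<Longrightarrow> \<bar>f x - f y\<bar> \<le> L * L2_set (\<lambda>i. x i - y i) {..n}"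
    using assms by (auto simp: sph_lipschitz_def)
  have "(f \<longlongrightarrow> f x) (at x within sph n)" if x: "x \<in> sph n" for x
  proof -
    have "continuous_on (sph n) (\<lambda>y. L * L2_set (\<lambda>i. y i - x i) {..n})"
      unfolding L2_set_def
      by (intro continuous_intros continuous_on_product_coordinates[THEN continuous_on_subset]) auto
    then have "((\<lambda>y. L * L2_set (\<lambda>i. y i - x i) {..n}) \<longlongrightarrow> L * L2_set (\<lambda>i. x i - x i) {..n}) (at x within sph n)"
      using x unfolding continuous_on_def by blast
    then have lim: "((\<lambda>y. L * L2_set (\<lambda>i. y i - x i) {..n}) \<longlongrightarrow> 0) (at x within sph n)"
      by (simp add: L2_set_0')
    have "((\<lambda>y. f y - f x) \<longlongrightarrow> 0) (at x within sph n)"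
      by (rule Lim_null_comparison[OF _ lim])
        (auto simp: eventually_at_filter x L(2) intro!: always_eventually)
    then show ?thesis
      by (subst Lim_null)
  qed
  then show ?thesis
    by (simp add: continuous_on_def)
qed

lemma sph_lipschitz_add:
  assumes "sph_lipschitz n f" "sph_lipschitz n g"
  shows "sph_lipschitz n (\<lambda>x. f x + g x)"
proof -
  obtain L where L: "L \<ge> 0"
    "\<And>x y. x \<in> sph n \<Longrightarrow> y \<in> sph n \<Longrightarrow> \<bar>f x - f y\<bar> \<le> L * L2_set (\<lambda>i. x i - y i) {..n}"
    using assms(1) by (auto simp: sph_lipschitz_def)
  obtain M where M: "M \<ge> 0"
    "\<And>x y. x \<in> sph n \<Longrightarrow> y \<in> sph n \<Longrightarrow> \<bar>g x - g y\<bar> \<le> M * L2_set (\<lambda>i. x i - y i) {..n}"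
    using assms(2) by (auto simp: sph_lipschitz_def)
  have "\<bar>f x + g x - (f y + g y)\<bar> \<le> (L + M) * L2_set (\<lambda>i. x i - y i) {..n}"
    if "x \<in> sph n" "y \<in> sph n" for x y
    using L(2)[OF that] M(2)[OF that] by (simp add: ring_distribs)
  with L(1) M(1) show ?thesis
    unfolding sph_lipschitz_def by (meson add_nonneg_nonneg)
qed

text \<open>The product estimate needs bounds for both factors, which continuity on the compact
  sphere provides.\<close>

lemma sph_lipschitz_mult:
  assumes "sph_lipschitz n f" "sph_lipschitz n g"
  shows "sph_lipschitz n (\<lambda>x. f x * g x)"
proof -
  obtain L where L: "L \<ge> 0"
    "\<And>x y. x \<in> sph n \<Longrightarrow> y \<in> sph n \<Longrightarrow> \<bar>f x - f y\<bar> \<le> L * L2_set (\<lambda>i. x i - y i) {..n}"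
    using assms(1) by (auto simp: sph_lipschitz_def)
  obtain M where M: "M \<ge> 0"
    "\<And>x y. x \<in> sph n \<Longrightarrow> y \<in> sph n \<Longrightarrow> \<bar>g x - g y\<bar> \<le> M * L2_set (\<lambda>i. x i - y i) {..n}"
    using assms(2) by (auto simp: sph_lipschitz_def)
  obtain F where F: "F \<ge> 0" "\<And>x. x \<in> sph n \<Longrightarrow> \<bar>f x\<bar> \<le> F"
    using compact_imp_bounded[OF compact_continuous_image[OF sph_lipschitz_continuous[OF assms(1)] compact_sph]]
    unfolding bounded_pos by (auto intro: less_imp_le)
  obtain H where H: "H \<ge> 0" "\<And>x. x \<in> sph n \<Longrightarrow> \<bar>g x\<bar> \<le> H"
    using compact_imp_bounded[OF compact_continuous_image[OF sph_lipschitz_continuous[OF assms(2)] compact_sph]]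
    unfolding bounded_pos by (auto intro: less_imp_le)
  have "\<bar>f x * g x - f y * g y\<bar> \<le> (F * M + L * H) * L2_set (\<lambda>i. x i - y i) {..n}"
    if "x \<in> sph n" "y \<in> sph n" for x y
  proof -
    have "f x * g x - f y * g y = f x * (g x - g y) + (f x - f y) * g y"
      by (simp add: algebra_simps)
    then have "\<bar>f x * g x - f y * g y\<bar> \<le> \<bar>f x\<bar> * \<bar>g x - g y\<bar> + \<bar>f x - f y\<bar> * \<bar>g y\<bar>"
      by (metis abs_mult abs_triangle_ineq)
    also have "\<dots> \<le> F * (M * L2_set (\<lambda>i. x i - y i) {..n}) + (L * L2_set (\<lambda>i. x i - y i) {..n}) * H"
      using that L M F H by (intro add_mono mult_mono) auto
    finally show ?thesis
      by (simp add: algebra_simps)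
  qed
  moreover have "F * M + L * H \<ge> 0"
    using L(1) M(1) F(1) H(1) by simp
  ultimately show ?thesis
    unfolding sph_lipschitz_def by blast
qed

lemma sph_lipschitz_coordinate:
  assumes "i \<le> n"
  shows "sph_lipschitz n (\<lambda>x. x i)"
  unfolding sph_lipschitz_def
proof (intro exI[of _ 1] conjI ballI)
  fix x y :: "nat \<Rightarrow> real"
  show "\<bar>x i - y i\<bar> \<le> 1 * L2_set (\<lambda>i. x i - y i) {..n}"
    using member_le_L2_set[of "{..n}" i "\<lambda>i. \<bar>x i - y i\<bar>"] assms
    by (simp add: L2_set_def)
qed auto

text \<open>The Lipschitz functions form a point-separating algebra with constants, so
  Stone-Weierstrass applies. Passing to the odd part restores the symmetry and keeps the bound e,
  because f itself is odd.\<close>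

lemma sph_odd_lipschitz_approx:
  assumes f: "continuous_on (sph n) f" and odd: "\<And>x. x \<in> sph n \<Longrightarrow> f (\<lambda>i. - x i) = - f x"
    and "0 < e"
  obtains g where "sph_lipschitz n g" "\<And>x. g (\<lambda>i. - x i) = - g x"
    "\<And>x. x \<in> sph n \<Longrightarrow> \<bar>f x - g x\<bar> < e"
proof -
  have "\<exists>g. sph_lipschitz n g \<and> (\<forall>x\<in>sph n. \<bar>f x - g x\<bar> < e)"
  proof (rule Stone_Weierstrass_HOL[OF compact_sph])
    fix x y assume xy: "x \<in> sph n \<and> y \<in> sph n \<and> x \<noteq> y"
    then obtain i where i: "x i \<noteq> y i"
      by blast
    with xy have "i \<le> n"
      by (metis not_le sph_above)
    with i show "\<exists>f. sph_lipschitz n f \<and> f x \<noteq> f y"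
      using sph_lipschitz_coordinate by blast
  next
    fix c show "sph_lipschitz n (\<lambda>x. c)"
      unfolding sph_lipschitz_def by (intro exI[of _ 0]) auto
  qed (use assms sph_lipschitz_add sph_lipschitz_mult sph_lipschitz_continuous in blast)+
  then obtain g where g: "sph_lipschitz n g" "\<And>x. x \<in> sph n \<Longrightarrow> \<bar>f x - g x\<bar> < e"
    by blast
  define k where "k x = (g x - g (\<lambda>i. - x i)) / 2" for x
  show ?thesis
  proof
    obtain L where L: "L \<ge> 0"
      "\<And>x y. x \<in> sph n \<Longrightarrow> y \<in> sph n \<Longrightarrow> \<bar>g x - g y\<bar> \<le> L * L2_set (\<lambda>i. x i - y i) {..n}"
      using g(1) by (auto simp: sph_lipschitz_def)
    have "\<bar>k x - k y\<bar> \<le> L * L2_set (\<lambda>i. x i - y i) {..n}" if "x \<in> sph n" "y \<in> sph n" for x y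
    proof -
      have "L2_set (\<lambda>i. - x i - - y i) {..n} = L2_set (\<lambda>i. x i - y i) {..n}"
        by (simp add: L2_set_def power2_commute)
      then show ?thesis
        using L(2)[OF that] L(2)[OF sph_minus[OF that(1)] sph_minus[OF that(2)]]
        by (simp add: k_def field_simps abs_if split: if_splits)
    qed
    with L(1) show "sph_lipschitz n k"
      unfolding sph_lipschitz_def by blast
    show "k (\<lambda>i. - x i) = - k x" for x
      by (simp add: k_def field_simps)
    show "\<bar>f x - k x\<bar> < e" if "x \<in> sph n" for x
      using g(2)[OF that] g(2)[OF sph_minus[OF that]] odd[OF that]
      by (simp add: k_def field_simps abs_if split: if_splits)
  qed
qed

section \<open>Cones over Lipschitz images of spheres\<close>

lemma L2_set_triangle_diff:
  "L2_set (\<lambda>i. x i - z i) A \<le> L2_set (\<lambda>i. x i - y i) A + L2_set (\<lambda>i. y i - (z i::real)) A"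
  using L2_set_triangle_ineq[of "\<lambda>i. x i - y i" "\<lambda>i. y i - z i" A] by simp

lemma L2_set_diff_commute: "L2_set (\<lambda>i. x i - y i) A = L2_set (\<lambda>i. y i - (x i::real)) A"
  by (simp add: L2_set_def power2_commute)

lemma L2_set_scale: "0 \<le> t \<Longrightarrow> L2_set (\<lambda>i. t * x i) A = t * L2_set x A"
  by (simp add: L2_set_right_distrib)

text \<open>Otherwise all \<open>N\<^sup>m\<^sup>+\<^sup>2\<close> points of the grid \<open>{1..N}\<^sup>m\<^sup>+\<^sup>2\<close> lie on the cone over the image, which is
  a Lipschitz image of \<open>\<real>\<^sup>m\<^sup>+\<^sup>1\<close>; a ball of radius proportional to \<open>N\<close> there has room for only
  \<open>O(N\<^sup>m\<^sup>+\<^sup>1)\<close> of them.\<close>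

lemma lipschitz_cone_misses_direction:
  fixes g :: "(nat \<Rightarrow> real) \<Rightarrow> nat \<Rightarrow> real"
  assumes lip: "\<And>i. i \<le> Suc m \<Longrightarrow> sph_lipschitz m (\<lambda>x. g x i)"
    and odd: "\<And>x i. x \<in> sph m \<Longrightarrow> i \<le> Suc m \<Longrightarrow> g (\<lambda>j. - x j) i = - g x i"
    and "0 < c" and lower: "\<And>x. x \<in> sph m \<Longrightarrow> \<exists>i\<le>Suc m. c \<le> \<bar>g x i\<bar>"
    and upper: "\<And>x i. x \<in> sph m \<Longrightarrow> i \<le> Suc m \<Longrightarrow> \<bar>g x i\<bar> \<le> b"
  obtains a :: "nat \<Rightarrow> real"
  where "\<And>i. i \<le> Suc m \<Longrightarrow> 0 < a i" "\<And>x t. x \<in> sph m \<Longrightarrow> \<exists>i\<le>Suc m. a i \<noteq> t * g x i"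
proof (rule ccontr)
  assume "\<not> thesis"
  with that have all: "\<exists>x t. x \<in> sph m \<and> (\<forall>i\<le>Suc m. a i = t * g x i)"
    if "\<And>i. i \<le> Suc m \<Longrightarrow> 0 < a i" for a
    using that by blast
  \<comment> \<open>If t is negative, oddness of g allows t and x to be replaced by their negatives,
    so non-negative radii suffice.\<close>
  have "\<exists>x t. 0 \<le> t \<and> x \<in> sph m \<and> (\<forall>i\<le>Suc m. a i = t * g x i)"
    if pos: "\<And>i. i \<le> Suc m \<Longrightarrow> 0 < a i" for a
  proof -
    obtain x t where xt: "x \<in> sph m" "\<And>i. i \<le> Suc m \<Longrightarrow> a i = t * g x i"
      using all[of a, OF pos] by blast
    show ?thesis
    proof (cases "0 \<le> t")
      case False
      have "a i = (- t) * g (\<lambda>j. - x j) i" if "i \<le> Suc m" for i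
        using xt odd that by simp
      with False sph_minus[OF xt(1)] show ?thesis
        by (metis neg_0_le_iff_le nle_le)
    qed (use xt in blast)
  qed
  then have "\<forall>a. \<exists>x t. (\<forall>i\<le>Suc m. 0 < a i) \<longrightarrow> 0 \<le> t \<and> x \<in> sph m \<and> (\<forall>i\<le>Suc m. a i = t * g x i)"
    by blast
  then obtain X T where XT: "\<And>a. (\<And>i. i \<le> Suc m \<Longrightarrow> 0 < a i) \<Longrightarrow> 0 \<le> T a \<and> X a \<in> sph m"
    "\<And>a i. (\<And>i. i \<le> Suc m \<Longrightarrow> 0 < a i) \<Longrightarrow> i \<le> Suc m \<Longrightarrow> a i = T a * g (X a) i"
    unfolding choice_iff by metis
  obtain l where l: "\<And>i. i \<le> Suc m \<Longrightarrow> 0 \<le> l i"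
    "\<And>i x y. i \<le> Suc m \<Longrightarrow> x \<in> sph m \<Longrightarrow> y \<in> sph m \<Longrightarrow>
       \<bar>g x i - g y i\<bar> \<le> l i * L2_set (\<lambda>j. x j - y j) {..m}"
    using lip unfolding sph_lipschitz_def by metis
  define L where "L = (\<Sum>i\<le>Suc m. l i)"
  have L: "\<bar>g x i - g y i\<bar> \<le> L * L2_set (\<lambda>j. x j - y j) {..m}"
    if "i \<le> Suc m" "x \<in> sph m" "y \<in> sph m" for i x y
  proof -
    have "l i \<le> L"
      unfolding L_def using that l(1) by (intro member_le_sum) auto
    then show ?thesis
      using l(2)[OF that] by (meson L2_set_nonneg mult_right_mono order_trans)
  qed
  have "0 \<le> L"
    unfolding L_def using l(1) by (intro sum_nonneg) auto
  have "0 \<le> b"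
    using upper[of "\<lambda>n. if n = 0 then 1 else 0" 0] in_topspace_nsphere[of m]
    unfolding topspace_nsphere_eq_sph by fastforce
  \<comment> \<open>Mesh width in R^(m+1), so small that cone parameters in one mesh cube belong to
    integer points less than 1 apart; the summand 1 keeps d finite and this bound strict.\<close>
  define d where "d = 1 / ((real m + 1) * (b + 2 * L) + 1)"
  have "0 < d"
    unfolding d_def using \<open>0 \<le> b\<close> \<open>0 \<le> L\<close> by (simp add: add_nonneg_pos)
  have d: "(real m + 1) * d * (b + 2 * L) < 1"
    unfolding d_def using \<open>0 \<le> b\<close> \<open>0 \<le> L\<close>
    by (auto simp: divide_simps add_nonneg_pos intro!: add_nonneg_pos)
  \<comment> \<open>Radii are at most N / c, so mesh indices are at most N / (c d) in absolute
    value, hence at most q N.\<close>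
  define q where "q = nat \<lceil>1 / (c * d)\<rceil>"
  have q: "1 / (c * d) \<le> real q"
    unfolding q_def by linarith
  \<comment> \<open>Now (2q + 1)^(m+1) equals N - 1, so the mesh cubes, at most (N - 1) N^(m+1) in
    number, are fewer than the N^(m+2) grid points.\<close>
  define N where "N = (2 * q + 1) ^ Suc m + 1"
  define A where "A = Pi\<^sub>E {..Suc m} (\<lambda>_. {1..N})"
  define v where "v a = (\<lambda>i. real (a i))" for a :: "nat \<Rightarrow> nat"
  have v: "0 \<le> T (v a)" "X (v a) \<in> sph m" "\<And>i. i \<le> Suc m \<Longrightarrow> real (a i) = T (v a) * g (X (v a)) i"
    if "a \<in> A" for a
  proof -
    have "0 < v a i" if "i \<le> Suc m" for i
      using \<open>a \<in> A\<close> that unfolding v_def A_def PiE_iff by force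
    from XT(1)[of "v a"] XT(2)[of "v a"] this
    show "0 \<le> T (v a)" "X (v a) \<in> sph m" "\<And>i. i \<le> Suc m \<Longrightarrow> real (a i) = T (v a) * g (X (v a)) i"
      by (auto simp: v_def)
  qed
  \<comment> \<open>The point with polar coordinates \<open>T (v a)\<close> and
    \<open>X (v a)\<close>; \<open>F a\<close> is the index of its mesh cube.\<close>
  define y where "y a = (\<lambda>i. T (v a) * X (v a) i)" for a
  define F where "F a = (\<lambda>i\<in>{..m}. \<lfloor>y a i / d\<rfloor>)" for a
  have T_le: "T (v a) \<le> real N / c" if a: "a \<in> A" for a
  proof -
    obtain i where i: "i \<le> Suc m" "c \<le> \<bar>g (X (v a)) i\<bar>"
      using lower[OF v(2)[OF a]] by blast
    then have "T (v a) * c \<le> T (v a) * \<bar>g (X (v a)) i\<bar>"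
      using v(1)[OF a] by (intro mult_left_mono)
    also have "\<dots> = \<bar>real (a i)\<bar>"
      using v(3)[OF a i(1)] v(1)[OF a] by (simp add: abs_mult)
    also have "\<dots> \<le> real N"
      using a i(1) by (auto simp: A_def PiE_iff)
    finally show ?thesis
      using \<open>0 < c\<close> by (simp add: field_simps)
  qed
  have "F ` A \<subseteq> Pi\<^sub>E {..m} (\<lambda>_. {- int (q * N)..int (q * N)})"
  proof (intro image_subsetI PiE_I)
    fix a i assume a: "a \<in> A" and i: "i \<in> {..m}"
    have "\<bar>y a i\<bar> \<le> T (v a) * 1"
      unfolding y_def abs_mult using v(1,2)[OF a] sph_abs_le[OF v(2)[OF a]]
      by (intro mult_mono) auto
    then have "\<bar>y a i / d\<bar> \<le> (real N / c) / d"
      using T_le[OF a] \<open>0 < d\<close> unfolding abs_divide by (intro frac_le) auto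
    also have "\<dots> = 1 / (c * d) * real N"
      by simp
    also have "\<dots> \<le> real q * real N"
      by (intro mult_right_mono q) auto
    finally have "\<bar>y a i / d\<bar> \<le> real_of_int (int (q * N))"
      by simp
    then have "y a i / d \<le> real_of_int (int (q * N))" "- real_of_int (int (q * N)) \<le> y a i / d"
      by linarith+
    then show "F a i \<in> {- int (q * N)..int (q * N)}"
      using i by (simp add: F_def floor_le_iff le_floor_iff del: of_nat_mult)
  qed (auto simp: F_def)
  \<comment> \<open>Equal indices force nearby radii and directions; the Lipschitz bound then puts
    the two integer points less than 1 apart in each coordinate.\<close>
  moreover have "inj_on F A"
  proof (rule inj_onI)
    fix a a' assume a: "a \<in> A" and a': "a' \<in> A" and eq: "F a = F a'"
    let ?t = "T (v a)" and ?t' = "T (v a')" and ?x = "X (v a)" and ?x' = "X (v a')"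
    have near: "\<bar>y a i - y a' i\<bar> \<le> d" if "i \<le> m" for i
    proof -
      have "\<lfloor>y a i / d\<rfloor> = \<lfloor>y a' i / d\<rfloor>"
        using fun_cong[OF eq, of i] that by (simp add: F_def)
      then have "\<bar>y a i / d - y a' i / d\<bar> \<le> 1"
        by linarith
      then show ?thesis
        using \<open>0 < d\<close> by (simp flip: diff_divide_distrib)
    qed
    define D where "D = L2_set (\<lambda>i. y a i - y a' i) {..m}"
    have "D \<le> (\<Sum>i\<le>m. \<bar>y a i - y a' i\<bar>)"
      unfolding D_def by (rule L2_set_le_sum_abs)
    also have "\<dots> \<le> (\<Sum>i\<le>m. d)"
      using near by (intro sum_mono) auto
    finally have D: "D \<le> (real m + 1) * d"
      by (simp add: add_ac)
    have norm_y: "L2_set (y a) {..m} = ?t" "L2_set (y a') {..m} = ?t'"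
      using v[OF a] v[OF a'] by (simp_all add: y_def L2_set_scale L2_set_sph)
    have t: "\<bar>?t - ?t'\<bar> \<le> D"
      using L2_set_triangle_ineq[of "y a'" "\<lambda>i. y a i - y a' i" "{..m}"]
        L2_set_triangle_ineq[of "y a" "\<lambda>i. y a' i - y a i" "{..m}"]
        L2_set_diff_commute[of "y a" "y a'" "{..m}"]
      by (simp add: norm_y D_def abs_le_iff)
    \<comment> \<open>Comparison through \<open>y a\<close>: the distance of the directions, scaled
      by one radius, is at most D plus the difference of the radii.\<close>
    have "?t' * L2_set (\<lambda>i. ?x i - ?x' i) {..m} = L2_set (\<lambda>i. ?t' * ?x i - y a' i) {..m}"
      using L2_set_scale[OF v(1)[OF a'], of "\<lambda>i. ?x i - ?x' i"] by (simp add: y_def algebra_simps)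
    also have "\<dots> \<le> L2_set (\<lambda>i. ?t' * ?x i - y a i) {..m} + D"
      unfolding D_def by (rule L2_set_triangle_diff)
    also have "L2_set (\<lambda>i. ?t' * ?x i - y a i) {..m} = L2_set (\<lambda>i. \<bar>?t' - ?t\<bar> * ?x i) {..m}"
      by (simp add: y_def L2_set_def power_mult_distrib flip: left_diff_distrib)
    also have "\<dots> = \<bar>?t' - ?t\<bar>"
      using v(2)[OF a] by (simp add: L2_set_scale L2_set_sph)
    finally have x: "?t' * L2_set (\<lambda>i. ?x i - ?x' i) {..m} \<le> 2 * D"
      using t by linarith
    have "a i = a' i" if i: "i \<le> Suc m" for i
    proof -
      \<comment> \<open>Splitting into a radial part, controlled by b, and an angular part,
        controlled by L.\<close>
      have "\<bar>real (a i) - real (a' i)\<bar> = \<bar>(?t - ?t') * g ?x i + ?t' * (g ?x i - g ?x' i)\<bar>"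
        unfolding v(3)[OF a i] v(3)[OF a' i] by (simp add: algebra_simps)
      also have "\<dots> \<le> \<bar>?t - ?t'\<bar> * \<bar>g ?x i\<bar> + ?t' * \<bar>g ?x i - g ?x' i\<bar>"
        using abs_triangle_ineq[of "(?t - ?t') * g ?x i" "?t' * (g ?x i - g ?x' i)"] v(1)[OF a']
        by (simp add: abs_mult)
      also have "\<dots> \<le> D * b + ?t' * (L * L2_set (\<lambda>i. ?x i - ?x' i) {..m})"
        using t upper[OF v(2)[OF a] i] L[OF i v(2)[OF a] v(2)[OF a']] v(1)[OF a']
        by (intro add_mono mult_mono mult_left_mono) (auto simp: D_def)
      also have "\<dots> = D * b + L * (?t' * L2_set (\<lambda>i. ?x i - ?x' i) {..m})"
        by simp
      also have "\<dots> \<le> D * b + L * (2 * D)"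
        using x \<open>0 \<le> L\<close> by (intro add_left_mono mult_left_mono)
      also have "\<dots> = D * (b + 2 * L)"
        by (simp add: algebra_simps)
      also have "\<dots> \<le> (real m + 1) * d * (b + 2 * L)"
        using D \<open>0 \<le> L\<close> \<open>0 \<le> b\<close> by (intro mult_right_mono) auto
      also note d
      finally show ?thesis
        by linarith
    qed
    then show "a = a'"
      using a a' by (intro PiE_ext[of a "{..Suc m}" _ a']) (auto simp: A_def)
  qed
  ultimately have "card A \<le> card (Pi\<^sub>E {..m} (\<lambda>_. {- int (q * N)..int (q * N)}))"
    by (metis card_image card_mono finite_PiE finite_atLeastAtMost_int finite_atMost)
  then have "N ^ Suc (Suc m) \<le> (2 * q * N + 1) ^ Suc m"
    by (simp add: A_def card_PiE mult_ac add_ac nat_add_distrib nat_mult_distrib)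
  also have "\<dots> \<le> ((2 * q + 1) * N) ^ Suc m"
    by (intro power_mono) (auto simp: N_def)
  also have "\<dots> = (N - 1) * N ^ Suc m"
    unfolding power_mult_distrib by (simp only: N_def add_diff_cancel_right')
  also have "\<dots> < N * N ^ Suc m"
    by (intro mult_strict_right_mono) (simp_all add: N_def)
  finally show False
    by simp
qed

section \<open>Degrees of odd maps and the Borsuk-Ulam theorem\<close>

lemma odd_Brouwer_degree2_of_odd_map:
  assumes "continuous_on (sph n) f" "f ` sph n \<subseteq> sph n"
    and "\<And>x. x \<in> sph n \<Longrightarrow> f (\<lambda>i. - x i) = (\<lambda>i. - f x i)"
  shows "odd (Brouwer_degree2 n f)"
  using assms
proof (induction n arbitrary: f)
  case 0
  \<comment> \<open>The sphere \<open>sph 0\<close> is a pair of antipodal points, so an odd map is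
    the identity or the reflection, of degree 1 or -1.\<close>
  define e where "e = (\<lambda>i::nat. if i = 0 then 1 else (0::real))"
  have e: "e \<in> sph 0" "x \<in> sph 0 \<longleftrightarrow> x = e \<or> x = (\<lambda>i. - e i)" for x
    by (auto simp: sph_def e_def power2_eq_1_iff fun_eq_iff)
  then consider "f e = e" | "f e = (\<lambda>i. - e i)"
    using 0 by blast
  then show ?case
  proof cases
    case 1
    then have "Brouwer_degree2 0 f = Brouwer_degree2 0 id"
      using 0(3)[OF e(1)] by (intro Brouwer_degree2_eq) (auto simp: topspace_nsphere_eq_sph e(2))
    then show ?thesis
      by simp
  next
    case 2
    moreover have "(\<lambda>i. if i = 0 then - e i else e i) = (\<lambda>i. - e i)"
      "(\<lambda>i. if i = 0 then - (- e i) else - e i) = e"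
      by (auto simp: e_def)
    ultimately have "Brouwer_degree2 0 f = Brouwer_degree2 0 (\<lambda>x i. if i = 0 then - x i else x i)"
      using 0(3)[OF e(1)]
      by (intro Brouwer_degree2_eq) (simp only: topspace_nsphere_eq_sph e(2), elim disjE, simp_all only: minus_minus)
    then show ?thesis
      by (simp add: Brouwer_degree2_reflection)
  qed
next
  case (Suc m)
  note f = Suc.prems
  \<comment> \<open>Some coordinate of \<open>f x\<close> has size at least 2 e, so every
    e-approximation keeps a coordinate of size e.\<close>
  define e where "e = 1 / (2 * (real m + 2))"
  have "0 < e" "e \<le> 1"
    by (simp_all add: e_def)
  have "\<exists>g. sph_lipschitz (Suc m) g \<and> (\<forall>x. g (\<lambda>i. - x i) = - g x) \<and>
      (\<forall>x\<in>sph (Suc m). \<bar>f x i - g x\<bar> < e)" for i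
  proof -
    have "continuous_on (sph (Suc m)) (\<lambda>x. f x i)"
      using f(1) by (rule continuous_on_product_then_coordinatewise)
    from sph_odd_lipschitz_approx[OF this _ \<open>0 < e\<close>] f(3) show ?thesis
      by metis
  qed
  then obtain g' where g': "\<And>i. sph_lipschitz (Suc m) (g' i)" "\<And>i x. g' i (\<lambda>j. - x j) = - g' i x"
      "\<And>i x. x \<in> sph (Suc m) \<Longrightarrow> \<bar>f x i - g' i x\<bar> < e"
    by metis
  define g where "g x i = g' i x" for x i
  have g_odd: "g (\<lambda>j. - x j) i = - g x i" for x i
    by (simp add: g_def g')
  have g_close: "\<bar>f x i - g x i\<bar> < e" if "x \<in> sph (Suc m)" for x i
    using that by (simp add: g_def g')
  have f_cont: "continuous_on (sph (Suc m)) (\<lambda>x. f x i)" for i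
    using f(1) by (rule continuous_on_product_then_coordinatewise)
  have g_cont: "continuous_on (sph (Suc m)) (\<lambda>x. g x i)" for i
    unfolding g_def by (rule sph_lipschitz_continuous[OF g'(1)])
  have f_large: "\<exists>i\<le>Suc m. 2 * e \<le> \<bar>f x i\<bar>" if "x \<in> sph (Suc m)" for x
  proof -
    have "f x \<in> sph (Suc m)"
      using f(2) that by blast
    then obtain i where "i \<le> Suc m" "1 / (real (Suc m) + 1) \<le> \<bar>f x i\<bar>"
      by (rule sph_coordinate_ge)
    moreover have "2 * e = 1 / (real (Suc m) + 1)"
      by (simp add: e_def field_simps)
    ultimately show ?thesis
      by auto
  qed
  have g_large: "\<exists>i\<le>Suc m. e \<le> \<bar>g x i\<bar>" if "x \<in> sph (Suc m)" for x
  proof -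
    obtain i where "i \<le> Suc m" "2 * e \<le> \<bar>f x i\<bar>"
      using f_large[OF \<open>x \<in> sph (Suc m)\<close>] by blast
    then show ?thesis
      using g_close[OF \<open>x \<in> sph (Suc m)\<close>, of i] by (intro exI[of _ i]) auto
  qed
  have equator: "x \<in> sph (Suc m)" "x (Suc m) = 0" if "x \<in> sph m" for x
    using that sph_Suc_iff[of x m] by auto
  \<comment> \<open>The cone lemma is applied to g on the equator alone: a sphere of dimension m
    mapped into R^(m+2) leaves a direction free.\<close>
  obtain a where a: "\<And>i. i \<le> Suc m \<Longrightarrow> 0 < a i"
    and cone: "\<And>x t. x \<in> sph m \<Longrightarrow> \<exists>i\<le>Suc m. a i \<noteq> t * g x i"
  proof (rule lipschitz_cone_misses_direction[of m g e 2])
    show "sph_lipschitz m (\<lambda>x. g x i)" for i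
    proof -
      obtain L where L: "L \<ge> 0" "\<And>x y. x \<in> sph (Suc m) \<Longrightarrow> y \<in> sph (Suc m) \<Longrightarrow>
          \<bar>g x i - g y i\<bar> \<le> L * L2_set (\<lambda>i. x i - y i) {..Suc m}"
        using g'(1)[of i] by (auto simp: sph_lipschitz_def g_def)
      have "L2_set (\<lambda>i. x i - y i) {..Suc m} = L2_set (\<lambda>i. x i - y i) {..m}"
        if "x \<in> sph m" "y \<in> sph m" for x y
        using equator(2)[OF that(1)] equator(2)[OF that(2)] by (simp add: L2_set_def)
      with L equator(1) show ?thesis
        unfolding sph_lipschitz_def by metis
    qed
    show "\<exists>i\<le>Suc m. e \<le> \<bar>g x i\<bar>" if "x \<in> sph m" for x
      using g_large equator(1)[OF that] by blast
    show "\<bar>g x i\<bar> \<le> 2" if "x \<in> sph m" for x i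
    proof -
      have "\<bar>f x i\<bar> \<le> 1"
        using f(2) equator(1)[OF that] by (intro sph_abs_le[of _ "Suc m"]) auto
      then show ?thesis
        using g_close[OF equator(1)[OF that], of i] \<open>e \<le> 1\<close> by linarith
    qed
  qed (use g_odd \<open>0 < e\<close> in auto)
  define H where "H t x i = (1 - t) * f x i + t * g x i" for t x i
  have deg_g: "Brouwer_degree2 (Suc m) f = Brouwer_degree2 (Suc m) (\<lambda>x. unit_vec (Suc m) (g x))"
  proof -
    have "Brouwer_degree2 (Suc m) (\<lambda>x. unit_vec (Suc m) (H 0 x)) =
        Brouwer_degree2 (Suc m) (\<lambda>x. unit_vec (Suc m) (H 1 x))"
    proof (rule Brouwer_degree2_unit_vec_homotopy)
      show "continuous_on ({0..1} \<times> sph (Suc m)) (\<lambda>z. H (fst z) (snd z) i)" for i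
        unfolding H_def
        by (intro continuous_intros continuous_on_compose2[OF f_cont] continuous_on_compose2[OF g_cont]) auto
      fix t :: real and x assume t: "0 \<le> t" "t \<le> 1" and x: "x \<in> sph (Suc m)"
      obtain i where i: "i \<le> Suc m" "2 * e \<le> \<bar>f x i\<bar>"
        using f_large[OF x] by blast
      \<comment> \<open>A coordinate of size at least 2 e moves by less than e along the segment, so
        it never reaches 0.\<close>
      have "\<bar>t * (f x i - g x i)\<bar> \<le> 1 * \<bar>f x i - g x i\<bar>"
        unfolding abs_mult using t by (intro mult_right_mono) auto
      also have "\<dots> < e"
        using g_close[OF x] by simp
      finally have "H t x i \<noteq> 0"
        using i(2) \<open>0 < e\<close> by (simp add: H_def algebra_simps abs_if split: if_splits)
      with i(1) show "\<exists>i\<le>Suc m. H t x i \<noteq> 0"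
        by blast
    qed
    moreover have "H 0 x = f x" "H 1 x = g x" for x
      by (simp_all add: H_def fun_eq_iff)
    moreover have "Brouwer_degree2 (Suc m) (\<lambda>x. unit_vec (Suc m) (f x)) = Brouwer_degree2 (Suc m) f"
      using f(2) by (intro Brouwer_degree2_eq unit_vec_sph) (auto simp: topspace_nsphere_eq_sph)
    ultimately show ?thesis
      by simp
  qed
  \<comment> \<open>\<open>K 1\<close> projects \<open>g x\<close> along \<open>a\<close> onto the equatorial hyperplane, completely so for \<open>x\<close> on the equator;
    the factor \<open>1 - (x (Suc m))\<^sup>2\<close> keeps it from vanishing where \<open>g x\<close> is a multiple of \<open>a\<close>.\<close>
  define K where "K t x i = g x i - t * ((1 - (x (Suc m))\<^sup>2) * (g x (Suc m) / a (Suc m)) * a i)"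
    for t :: real and x i
  have K_cont: "continuous_on ({0..1} \<times> sph (Suc m)) (\<lambda>z. K (fst z) (snd z) i)" for i
    unfolding K_def
    by (intro continuous_intros continuous_on_compose2[OF g_cont]
        continuous_on_compose2[OF continuous_on_product_coordinates]) (use a[of "Suc m"] in auto)
  have K_nz: "\<exists>i\<le>Suc m. K t x i \<noteq> 0" if t: "0 \<le> t" "t \<le> 1" and x: "x \<in> sph (Suc m)" for t x
  proof (rule ccontr)
    assume "\<not> ?thesis"
    then have K0: "K t x i = 0" if "i \<le> Suc m" for i
      using that by blast
    define r where "r = t * ((1 - (x (Suc m))\<^sup>2) * (g x (Suc m) / a (Suc m)))"
    have g_eq: "g x i = r * a i" if "i \<le> Suc m" for i
      using K0[OF that] by (simp add: K_def r_def)
    have "r \<noteq> 0"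
      using g_large[OF x] g_eq \<open>0 < e\<close> by fastforce
    \<comment> \<open>On the equator, a would be a multiple of \<open>g x\<close>, contrary to its
      choice.\<close>
    have "x (Suc m) \<noteq> 0"
    proof
      assume "x (Suc m) = 0"
      with x have "x \<in> sph m"
        using sph_Suc_iff[of x m] by simp
      then obtain i where "i \<le> Suc m" "a i \<noteq> (1 / r) * g x i"
        using cone by blast
      then show False
        using g_eq \<open>r \<noteq> 0\<close> by simp
    qed
    \<comment> \<open>Comparing last coordinates forces \<open>t * (1 - (x (Suc m))\<^sup>2)\<close>
      to be 1, whereas off the equator it is less than 1.\<close>
    have "r = t * ((1 - (x (Suc m))\<^sup>2) * r)"
      using g_eq[of "Suc m"] a[of "Suc m"] by (simp add: r_def[symmetric]) (simp add: r_def)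
    then have "t * (1 - (x (Suc m))\<^sup>2) = 1"
      using \<open>r \<noteq> 0\<close> by simp
    moreover have "t * (1 - (x (Suc m))\<^sup>2) \<le> 1 * (1 - (x (Suc m))\<^sup>2)"
      using t sph_abs_le[OF x] by (intro mult_right_mono) (auto simp: abs_square_le_1)
    ultimately show False
      using \<open>x (Suc m) \<noteq> 0\<close> by simp
  qed
  define F where "F x = unit_vec (Suc m) (K 1 x)" for x
  have deg_F: "Brouwer_degree2 (Suc m) (\<lambda>x. unit_vec (Suc m) (g x)) = Brouwer_degree2 (Suc m) F"
  proof -
    have "K 0 x = g x" for x
      by (simp add: K_def fun_eq_iff)
    then show ?thesis
      using Brouwer_degree2_unit_vec_homotopy[of "Suc m" K, OF K_cont K_nz] by (simp add: F_def[abs_def])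
  qed
  have F_cont: "continuous_on (sph (Suc m)) F"
    unfolding F_def
  proof (rule continuous_on_unit_vec)
    show "continuous_on (sph (Suc m)) (\<lambda>x. K 1 x i)" for i
    proof -
      have "continuous_on (sph (Suc m)) (\<lambda>x. (1::real, x))"
        by (intro continuous_on_Pair continuous_on_const continuous_on_id)
      moreover have "Pair 1 ` sph (Suc m) \<subseteq> {0..1::real} \<times> sph (Suc m)"
        by auto
      ultimately show ?thesis
        using continuous_on_compose2[OF K_cont[of i]] by fastforce
    qed
  qed (use K_nz[of 1] in \<open>force simp: L2_set_eq_0_iff\<close>)
  have F_im: "F ` sph (Suc m) \<subseteq> sph (Suc m)"
    unfolding F_def using K_nz[of 1] by (force simp: L2_set_eq_0_iff intro!: unit_vec_in_sph)
  have F_odd: "F (\<lambda>i. - x i) = (\<lambda>i. - F x i)" for x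
    unfolding F_def unit_vec_minus[symmetric]
    by (rule arg_cong[where f = "unit_vec (Suc m)"]) (auto simp: K_def g_odd algebra_simps)
  have F_eq: "F ` sph m \<subseteq> sph m"
  proof (rule image_subsetI)
    fix x assume x: "x \<in> sph m"
    \<comment> \<open>On the equator the damping factor is 1, so the projection along a kills the
      last coordinate exactly.\<close>
    have "K 1 x (Suc m) = 0"
      using equator(2)[OF x] a[of "Suc m"] by (simp add: K_def)
    then show "F x \<in> sph m"
      using F_im equator(1)[OF x] unfolding sph_Suc_iff[of _ m] by (auto simp: F_def unit_vec_def)
  qed
  have "odd (Brouwer_degree2 m F)"
    using F_odd F_eq equator(1) by (intro Suc.IH continuous_on_subset[OF F_cont]) auto
  moreover have "even (Brouwer_degree2 (Suc m) F - Brouwer_degree2 (Suc m - Suc 0) F)"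
  proof (rule Borsuk_odd_mapping_degree_step)
    show "continuous_map (nsphere (Suc m)) (nsphere (Suc m)) F"
      using F_cont F_im by (simp add: continuous_map_nsphere_iff)
  qed (use F_odd F_eq in \<open>auto simp: topspace_nsphere_eq_sph\<close>)
  ultimately show ?case
    by (simp add: deg_g deg_F)
qed

text \<open>Without a common zero, padding by zero coordinates and normalising gives an odd self-map
  of \<open>sph p\<close>. As m \<le> p, its coordinate p is always 0, so it misses the pole and has
  degree 0, which is not odd.\<close>

theorem Borsuk_Ulam_nsphere:
  fixes \<phi> :: "(nat \<Rightarrow> real) \<Rightarrow> nat \<Rightarrow> real"
  assumes cont: "\<And>i. i < m \<Longrightarrow> continuous_on (sph p) (\<lambda>x. \<phi> x i)"
    and odd: "\<And>x i. x \<in> sph p \<Longrightarrow> i < m \<Longrightarrow> \<phi> (\<lambda>j. - x j) i = - \<phi> x i"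
    and "m \<le> p"
  obtains x where "x \<in> sph p" "\<And>i. i < m \<Longrightarrow> \<phi> x i = 0"
proof (rule ccontr)
  assume "\<not> thesis"
  with that have nz: "\<exists>i<m. \<phi> x i \<noteq> 0" if "x \<in> sph p" for x
    using that by blast
  define \<psi> where "\<psi> x i = (if i < m then \<phi> x i else 0)" for x i
  define f where "f x = unit_vec p (\<psi> x)" for x
  have ne: "L2_set (\<psi> x) {..p} \<noteq> 0" if x: "x \<in> sph p" for x
  proof -
    obtain i where "i < m" "\<phi> x i \<noteq> 0"
      using nz[OF x] by blast
    then show ?thesis
      using \<open>m \<le> p\<close> by (intro L2_set_ne_0I[of _ i]) (auto simp: \<psi>_def)
  qed
  have f_cont: "continuous_on (sph p) f"
    unfolding f_def
  proof (rule continuous_on_unit_vec)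
    show "continuous_on (sph p) (\<lambda>x. \<psi> x i)" for i
      using cont by (cases "i < m") (auto simp: \<psi>_def)
  qed (use ne in auto)
  have f_im: "f ` sph p \<subseteq> sph p"
    unfolding f_def using ne by (auto intro!: unit_vec_in_sph)
  have "f (\<lambda>j. - x j) = (\<lambda>i. - f x i)" if "x \<in> sph p" for x
    unfolding f_def unit_vec_minus[symmetric]
    using odd[OF that] by (intro arg_cong[where f = "unit_vec p"]) (auto simp: \<psi>_def)
  then have "odd (Brouwer_degree2 p f)"
    by (intro odd_Brouwer_degree2_of_odd_map f_cont f_im)
  moreover have "Brouwer_degree2 p f = 0"
  proof (rule Brouwer_degree2_nonsurjective)
    have "(\<lambda>i. if i = p then 1 else 0) \<in> sph p"
      by (auto simp: sph_def if_distrib[of "\<lambda>t. t ^ 2"] cong: if_cong)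
    moreover have "f x p = 0" for x
      using \<open>m \<le> p\<close> by (simp add: f_def unit_vec_def \<psi>_def)
    ultimately show "f ` topspace (nsphere p) \<noteq> topspace (nsphere p)"
      unfolding topspace_nsphere_eq_sph by (metis (mono_tags, lifting) imageE zero_neq_one)
  qed (simp add: continuous_map_nsphere_iff f_cont f_im)
  ultimately show False
    by simp
qed

section \<open>Young functions and the energy\<close>

lemma young_density_nonneg: "young_density g \<Longrightarrow> 0 \<le> t \<Longrightarrow> 0 \<le> g t"
  unfolding young_density_def by (metis less_eq_real_def)

lemma young_density_mono:
  assumes "young_density g" "0 \<le> x" "x \<le> y"
  shows "g x \<le> g y"
proof (cases "x = 0")
  case True
  then show ?thesis
    using assms young_density_nonneg[OF assms(1), of y] by (simp add: young_density_def)
next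
  case False
  then show ?thesis
    using assms by (auto simp: young_density_def mono_on_def)
qed

lemma young_density_integrable:
  assumes "young_density g" "0 \<le> x"
  shows "g integrable_on {x..y}"
  using assms by (intro integrable_on_mono_on mono_onI young_density_mono[OF assms(1)]) auto

text \<open>The integral runs over an empty or one-point interval. This extension by 0 makes the
  primitive monotone, hence Borel, on the whole line.\<close>

lemma young_primitive_nonpos: "t \<le> 0 \<Longrightarrow> young_primitive g t = 0"
  by (cases "t = 0") (auto simp: young_primitive_def)

text \<open>Convexity in the form used throughout: as g is non-decreasing, its integral between a
  and b is compared with that of the constant \<open>g a\<close>.\<close>

lemma young_primitive_subgradient:
  assumes g: "young_density g" and "0 \<le> a" "0 \<le> b"
  shows "young_primitive g a + g a * (b - a) \<le> young_primitive g b"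
proof -
  have int: "g integrable_on {x..y}" if "0 \<le> x" for x y
    by (rule young_density_integrable[OF g that])
  show ?thesis
  proof (cases "a \<le> b")
    case True
    have "integral {a..b} (\<lambda>_. g a) \<le> integral {a..b} g"
      by (rule integral_le[OF integrable_const_ivl int]) (use assms young_density_mono[OF g] in auto)
    moreover have "integral {0..a} g + integral {a..b} g = integral {0..b} g"
      by (rule Henstock_Kurzweil_Integration.integral_combine[OF \<open>0 \<le> a\<close> True int]) simp
    ultimately show ?thesis
      using True by (simp add: young_primitive_def mult.commute)
  next
    case False
    have "integral {b..a} g \<le> integral {b..a} (\<lambda>_. g a)"
      by (rule integral_le[OF int integrable_const_ivl]) (use assms young_density_mono[OF g] in auto)
    moreover have "integral {0..b} g + integral {b..a} g = integral {0..a} g"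
      using False by (intro Henstock_Kurzweil_Integration.integral_combine[OF \<open>0 \<le> b\<close> _ int]) auto
    ultimately show ?thesis
      using False by (simp add: young_primitive_def algebra_simps)
  qed
qed

lemma young_primitive_mono:
  assumes "young_density g"
  shows "mono (young_primitive g)"
proof (rule monoI)
  fix x y :: real assume "x \<le> y"
  have nonneg: "0 \<le> young_primitive g y" if "0 \<le> y"
    using young_primitive_subgradient[OF assms order_refl that] young_density_nonneg[OF assms order_refl] that
    by (simp add: young_primitive_nonpos) (meson mult_nonneg_nonneg order_trans)
  show "young_primitive g x \<le> young_primitive g y"
  proof (cases "0 \<le> x")
    case True
    then have "0 \<le> g x * (y - x)"
      using \<open>x \<le> y\<close> young_density_nonneg[OF assms True] by simp
    then show ?thesis
      using young_primitive_subgradient[OF assms True, of y] True \<open>x \<le> y\<close> by simp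
  next
    case False
    then show ?thesis
      using nonneg by (cases "0 \<le> y") (auto simp: young_primitive_nonpos)
  qed
qed

lemma young_primitive_nonneg: "young_density g \<Longrightarrow> 0 \<le> young_primitive g t"
  using monoD[OF young_primitive_mono, of g "min 0 t" t] by (simp add: young_primitive_nonpos)

lemma young_primitive_pos:
  assumes g: "young_density g" and "0 < t"
  shows "0 < young_primitive g t"
proof -
  have "0 < g (t / 2) * (t - t / 2)"
    using assms by (simp add: young_density_def)
  then show ?thesis
    using young_primitive_subgradient[OF g, of "t / 2" t] young_primitive_nonneg[OF g, of "t / 2"] assms
    by linarith
qed

text \<open>The subgradient inequalities at c t, evaluated at t and at 0 with weights c and 1 - c,
  add up so that the linear terms cancel.\<close>

lemma young_primitive_scale_le:
  assumes g: "young_density g" and c: "0 \<le> c" "c \<le> 1" and "0 \<le> t"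
  shows "young_primitive g (c * t) \<le> c * young_primitive g t"
proof -
  have "c * (young_primitive g (c * t) + g (c * t) * (t - c * t)) +
      (1 - c) * (young_primitive g (c * t) + g (c * t) * (0 - c * t))
      \<le> c * young_primitive g t + (1 - c) * young_primitive g 0"
    using assms by (intro add_mono mult_left_mono young_primitive_subgradient) auto
  then show ?thesis
    by (simp add: young_primitive_nonpos algebra_simps)
qed

text \<open>Gives integrability on sets of finite measure from a finite modular; for t > 1 it is the
  scaling inequality with factor 1 / t.\<close>

lemma young_primitive_linear_bound:
  assumes g: "young_density g" and "0 \<le> t"
  shows "t \<le> 1 + young_primitive g t / young_primitive g 1"
proof (cases "t \<le> 1")
  case True
  then show ?thesis
    using young_primitive_nonneg[OF g, of t] young_primitive_nonneg[OF g, of 1]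
    by (simp add: add_increasing2)
next
  case False
  have "young_primitive g ((1 / t) * t) \<le> (1 / t) * young_primitive g t"
    using False by (intro young_primitive_scale_le g) auto
  then have "t \<le> young_primitive g t / young_primitive g 1"
    using False young_primitive_pos[OF g, of 1] by (simp add: field_simps)
  then show ?thesis
    by simp
qed

text \<open>Since |a - b| is at most twice the larger of |a| and |b|, scaling suffices. It bounds
  the modular of a scaled difference by the modulars of the two functions.\<close>

lemma young_primitive_add_scale_le:
  assumes g: "young_density g" and "2 \<le> c"
  shows "young_primitive g (\<bar>a - b\<bar> / c) \<le> (2 / c) * (young_primitive g \<bar>a\<bar> + young_primitive g \<bar>b\<bar>)"
proof -
  define m where "m = max \<bar>a\<bar> \<bar>b\<bar>"
  have "\<bar>a - b\<bar> / c \<le> (2 / c) * m"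
    using assms by (auto simp: m_def field_simps)
  then have "young_primitive g (\<bar>a - b\<bar> / c) \<le> young_primitive g ((2 / c) * m)"
    by (rule monoD[OF young_primitive_mono[OF g]])
  also have "\<dots> \<le> (2 / c) * young_primitive g m"
    using assms by (intro young_primitive_scale_le) (auto simp: m_def)
  also have "\<dots> \<le> (2 / c) * (young_primitive g \<bar>a\<bar> + young_primitive g \<bar>b\<bar>)"
    using young_primitive_nonneg[OF g] \<open>2 \<le> c\<close>
    by (intro mult_left_mono) (auto simp: m_def max_def add_increasing add_increasing2)
  finally show ?thesis .
qed

lemma borel_measurable_young_primitive [measurable]:
  "young_density g \<Longrightarrow> young_primitive g \<in> borel_measurable borel"
  by (intro borel_measurable_mono young_primitive_mono)

lemma borel_measurable_young_density_abs:
  assumes "young_density g"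
  shows "(\<lambda>t. g \<bar>t\<bar>) \<in> borel_measurable borel"
proof -
  \<comment> \<open>Monotonicity of g is known on the half-line only, so it is first extended by
    \<open>max 0\<close>.\<close>
  have "mono (\<lambda>t. g (max 0 t))"
  proof (rule monoI)
    fix x y :: real assume "x \<le> y"
    then show "g (max 0 x) \<le> g (max 0 y)"
      by (intro young_density_mono[OF assms]) simp_all
  qed
  then have [measurable]: "(\<lambda>t. g (max 0 t)) \<in> borel_measurable borel"
    by (rule borel_measurable_mono)
  have "(\<lambda>t. g (max 0 \<bar>t\<bar>)) \<in> borel_measurable borel"
    by (rule measurable_compose[where f = abs]) measurable
  then show ?thesis
    by simp
qed

section \<open>Jensen's inequality and the energy density\<close>

lemma ennreal_integral_le_nn_integral:
  fixes f :: "'a \<Rightarrow> real"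
  assumes "integrable M f"
  shows "ennreal (integral\<^sup>L M f) \<le> (\<integral>\<^sup>+x. ennreal (f x) \<partial>M)"
proof -
  have "integral\<^sup>L M f \<le> enn2real (\<integral>\<^sup>+x. ennreal (f x) \<partial>M)"
    \<comment> \<open>The right-hand side is the integral of the positive part; the negative part
      only lowers the left-hand side.\<close>
    unfolding real_lebesgue_integral_def[OF assms] by simp
  then have "ennreal (integral\<^sup>L M f) \<le> ennreal (enn2real (\<integral>\<^sup>+x. ennreal (f x) \<partial>M))"
    by (rule ennreal_leI)
  also have "\<dots> = (\<integral>\<^sup>+x. ennreal (f x) \<partial>M)"
    using assms by (simp add: real_integrable_def less_top)
  finally show ?thesis .
qed

text \<open>Jensen's inequality for the mean-zero function \<open>u\<close>, through the subgradient of the Young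
  function at \<open>\<bar>u x\<bar>\<close>.\<close>

lemma young_primitive_mean_zero_le:
  fixes u :: "'a \<Rightarrow> real"
  assumes g: "young_density g" and A: "A \<in> sets M" "emeasure M A < \<infinity>"
    and u: "set_integrable M A u" "(LINT y:A|M. u y) = 0"
  shows "ennreal (measure M A) * ennreal (young_primitive g \<bar>c\<bar>)
    \<le> (\<integral>\<^sup>+y\<in>A. ennreal (young_primitive g \<bar>c - u y\<bar>) \<partial>M)"
proof -
  \<comment> \<open>An affine minorant of the integrand: |c - u y| - |c| is at least - sgn c * u y,
    and this linear term has integral zero over A.\<close>
  let ?f = "\<lambda>y. indicator A y *\<^sub>R (young_primitive g \<bar>c\<bar> + g \<bar>c\<bar> * (- sgn c * u y))"
  have const: "set_integrable M A (\<lambda>_. young_primitive g \<bar>c\<bar>)"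
    using A by (simp add: set_integrable_def)
  have lin: "set_integrable M A (\<lambda>y. g \<bar>c\<bar> * (- sgn c * u y))"
    using u(1) by (intro set_integrable_mult_right) auto
  have "(LINT y:A|M. young_primitive g \<bar>c\<bar> + g \<bar>c\<bar> * (- sgn c * u y)) = measure M A * young_primitive g \<bar>c\<bar>"
  proof -
    have "(LINT y:A|M. g \<bar>c\<bar> * (- sgn c * u y)) = g \<bar>c\<bar> * (- sgn c) * (LINT y:A|M. u y)"
      by (subst set_integral_mult_right[symmetric]) (simp add: mult.assoc)
    then show ?thesis
      using A u(2) by (subst set_integral_add(2)[OF const lin]) (simp add: set_lebesgue_integral_def)
  qed
  moreover have int: "integrable M ?f"
    using set_integral_add(1)[OF const lin] by (simp add: set_integrable_def)
  ultimately have "ennreal (measure M A * young_primitive g \<bar>c\<bar>) \<le> (\<integral>\<^sup>+y. ennreal (?f y) \<partial>M)"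
    using ennreal_integral_le_nn_integral[OF int] by (simp add: set_lebesgue_integral_def)
  also have "\<dots> \<le> (\<integral>\<^sup>+y\<in>A. ennreal (young_primitive g \<bar>c - u y\<bar>) \<partial>M)"
  proof (rule nn_integral_mono)
    fix y
    have "young_primitive g \<bar>c\<bar> + g \<bar>c\<bar> * (- sgn c * u y)
        \<le> young_primitive g \<bar>c\<bar> + g \<bar>c\<bar> * (\<bar>c - u y\<bar> - \<bar>c\<bar>)"
      by (intro add_left_mono mult_left_mono young_density_nonneg[OF g]) (auto simp: sgn_if)
    also have "\<dots> \<le> young_primitive g \<bar>c - u y\<bar>"
      by (intro young_primitive_subgradient g) auto
    finally show "ennreal (?f y) \<le> ennreal (young_primitive g \<bar>c - u y\<bar>) * indicator A y"
      by (auto simp: indicator_def intro!: ennreal_leI)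
  qed
  finally show ?thesis
    by (simp add: ennreal_mult young_primitive_nonneg[OF g])
qed

text \<open>With r = |x - y| \<le> 1, scaling pulls the factor r^s out of the Young function; then
  r^s \<le> d^s, and inserting (d / r)^n \<ge> 1 produces the weight of \<open>mu\<close>.\<close>

lemma young_primitive_diff_le_energy_density:
  fixes x y :: "'a::euclidean_space"
  assumes g: "young_density g" and "0 < s" and d: "norm (x - y) \<le> d" "d \<le> 1"
  shows "young_primitive g \<bar>u x - u y\<bar>
    \<le> d powr s * d ^ DIM('a) * (1 / norm (x - y) ^ DIM('a) * young_primitive g \<bar>Ds s u (x, y)\<bar>)"
proof (cases "x = y")
  case True
  then have "0 \<le> d"
    using d by simp
  then show ?thesis
    using True by (auto simp: young_primitive_nonpos intro!: mult_nonneg_nonneg divide_nonneg_nonneg young_primitive_nonneg[OF g])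
next
  case False
  define r where "r = norm (x - y)"
  have r: "0 < r" "r \<le> d" "r powr s \<le> d powr s"
    using False d \<open>0 < s\<close> by (auto simp: r_def intro!: powr_mono2)
  have "\<bar>u x - u y\<bar> = r powr s * \<bar>Ds s u (x, y)\<bar>"
    using r by (simp add: Ds_def r_def abs_mult)
  also have "young_primitive g \<dots> \<le> r powr s * young_primitive g \<bar>Ds s u (x, y)\<bar>"
    using r d \<open>0 < s\<close> by (intro young_primitive_scale_le g powr_le1) auto
  also have "\<dots> \<le> d powr s * (d / r) ^ DIM('a) * young_primitive g \<bar>Ds s u (x, y)\<bar>"
  proof (rule mult_right_mono[OF _ young_primitive_nonneg[OF g]])
    have "1 \<le> (d / r) ^ DIM('a)"
      using r by (intro one_le_power) simp
    then have "r powr s * 1 \<le> d powr s * (d / r) ^ DIM('a)"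
      using r by (intro mult_mono) auto
    then show "r powr s \<le> d powr s * (d / r) ^ DIM('a)"
      by simp
  qed
  finally show ?thesis
    by (simp add: r_def power_divide)
qed

section \<open>Null sets, measurability and the measure \<open>mu\<close>\<close>

lemma borel_measurable_lebesgue_AE_eq:
  fixes f f' :: "'a::euclidean_space \<Rightarrow> 'b::topological_space"
  assumes "f' \<in> borel_measurable lborel" "AE x in lebesgue. f x = f' x"
  shows "f \<in> borel_measurable lebesgue"
proof (rule measurableI)
  fix B :: "'b set" assume "B \<in> sets borel"
  then have "f' -` B \<inter> space lebesgue \<in> sets lebesgue"
    by (rule measurable_sets[OF measurable_completion[OF assms(1)]])
  moreover have "AE x in lebesgue. x \<in> f' -` B \<inter> space lebesgue \<longleftrightarrow> x \<in> f -` B \<inter> space lebesgue"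
    using assms(2) by eventually_elim auto
  ultimately show "f -` B \<inter> space lebesgue \<in> sets lebesgue"
    using completion.in_sets_AE by blast
qed simp

text \<open>A Borel null set N containing the exceptions gives two null strips N x UNIV and UNIV x
  N. The product is formed with \<open>lborel\<close>, where it agrees with the measure on the
  product type, and completed afterwards.\<close>

lemma AE_lebesgue_pair:
  assumes "AE x in lebesgue. P (x::'a::euclidean_space)"
  shows "AE z in (lebesgue :: ('a \<times> 'a) measure). P (fst z) \<and> P (snd z)"
proof -
  obtain N where N: "N \<in> null_sets lborel" "\<And>x. \<not> P x \<Longrightarrow> x \<in> N"
  proof -
    have "AE x in lborel. P x"
      using assms by (simp add: AE_completion_iff)
    then obtain N where "{x \<in> space lborel. \<not> P x} \<subseteq> N" "emeasure lborel N = 0" "N \<in> sets lborel"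
      by (rule AE_E)
    then show ?thesis
      using that[of N] by (auto simp: null_sets_def)
  qed
  have "N \<times> UNIV \<in> null_sets (lborel \<Otimes>\<^sub>M (lborel :: 'a measure))"
    "UNIV \<times> N \<in> null_sets (lborel \<Otimes>\<^sub>M (lborel :: 'a measure))"
    using N(1) by (auto intro: lborel.times_in_null_sets1 lborel.times_in_null_sets2)
  then have "N \<times> UNIV \<union> UNIV \<times> N \<in> null_sets (lborel :: ('a \<times> 'a) measure)"
    unfolding lborel_prod by (rule null_sets.Un)
  then have "AE z in (lborel :: ('a \<times> 'a) measure). P (fst z) \<and> P (snd z)"
    by (rule AE_I') (use N(2) in auto)
  then show ?thesis
    by (rule AE_completion)
qed

lemma lebesgue_borel_representative:
  fixes u :: "'a::euclidean_space \<Rightarrow> real"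
  assumes "u \<in> borel_measurable lebesgue"
  obtains u' where "u' \<in> borel_measurable lborel" "AE x in lebesgue. u x = u' x"
  using completion_ex_borel_measurable_real[OF assms] AE_completion by blast

lemma borel_measurable_mu_density:
  "(\<lambda>z. 1 / norm (fst z - snd z) ^ DIM('a)) \<in> borel_measurable (lborel :: ('a::euclidean_space \<times> 'a) measure)"
proof -
  have "(\<lambda>z. 1 / norm (fst z - snd z) ^ DIM('a)) \<in> borel_measurable (borel :: ('a \<times> 'a) measure)"
    by (subst borel_prod[symmetric]) measurable
  then show ?thesis
    by simp
qed

lemma mu_density_pos_iff: "0 < ennreal (1 / norm v ^ DIM('a)) \<longleftrightarrow> v \<noteq> (0 :: 'a::euclidean_space)"
  by (cases "v = 0") (auto simp: zero_power)

text \<open>The density vanishes exactly on the diagonal, by division by zero, and is positive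
  elsewhere.\<close>

lemma AE_mu_iff_offdiag:
  "(AE z in (mu :: ('a::euclidean_space \<times> 'a) measure). P z) \<longleftrightarrow> (AE z in lebesgue. fst z \<noteq> snd z \<longrightarrow> P z)"
  unfolding mu_def
  by (subst AE_density)
    (auto simp: case_prod_beta' mu_density_pos_iff simp del: ennreal_less_zero_iff
      intro!: measurable_compose[OF _ measurable_ennreal] measurable_completion[OF borel_measurable_mu_density])

lemma AE_mu_Ds_eq:
  assumes "AE x in lebesgue. u x = u' x"
  shows "AE z in mu. Ds s u z = Ds s u' z"
  unfolding AE_mu_iff_offdiag using AE_lebesgue_pair[OF assms]
  by eventually_elim (auto simp: Ds_def)

lemma borel_measurable_Ds_lborel:
  assumes "u \<in> borel_measurable lborel"
  shows "Ds s u \<in> borel_measurable (lborel :: ('a::euclidean_space \<times> 'a) measure)"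
proof -
  have [measurable]: "u \<in> borel_measurable borel"
    using assms by simp
  have "(\<lambda>z. (u (fst z) - u (snd z)) / norm (fst z - snd z) powr s) \<in> borel_measurable (borel :: ('a \<times> 'a) measure)"
    by (subst borel_prod[symmetric]) measurable
  then show ?thesis
    by (simp add: Ds_def case_prod_beta')
qed

lemma borel_measurable_Ds_mu:
  assumes "u \<in> borel_measurable lebesgue"
  shows "Ds s u \<in> borel_measurable mu"
proof -
  obtain u' where u': "u' \<in> borel_measurable lborel" "AE x in lebesgue. u x = u' x"
    using assms by (rule lebesgue_borel_representative)
  have "AE z in lebesgue. Ds s u z = Ds s u' z"
    using AE_lebesgue_pair[OF u'(2)] by eventually_elim (auto simp: Ds_def)
  then have "Ds s u \<in> borel_measurable lebesgue"
    by (rule borel_measurable_lebesgue_AE_eq[OF borel_measurable_Ds_lborel[OF u'(1)]])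
  then show ?thesis
    by (simp add: mu_def measurable_def)
qed

lemma modular_J_cong_AE:
  "AE x in lebesgue. u x = u' x \<Longrightarrow> modular_J g s u = modular_J g s u'"
  unfolding modular_J_def using AE_mu_Ds_eq[of u u' s]
  by (intro nn_integral_cong_AE) (auto elim!: eventually_mono)

text \<open>Brings the energy into the form of an integral over a product of \<open>lborel\<close>,
  to which Tonelli's theorem applies.\<close>

lemma modular_J_lborel:
  fixes u :: "'a::euclidean_space \<Rightarrow> real"
  assumes g: "young_density g" and u: "u \<in> borel_measurable lborel"
  shows "modular_J g s u = (\<integral>\<^sup>+z. ennreal (1 / norm (fst z - snd z) ^ DIM('a) *
    young_primitive g \<bar>Ds s u z\<bar>) \<partial>(lborel \<Otimes>\<^sub>M lborel))"
proof -
  note [measurable] = borel_measurable_Ds_lborel[OF u, of s] borel_measurable_young_primitive[OF g]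
  have "modular_J g s u = (\<integral>\<^sup>+z. ennreal (1 / norm (fst z - snd z) ^ DIM('a)) *
      ennreal (young_primitive g \<bar>Ds s u z\<bar>) \<partial>lebesgue)"
    unfolding modular_J_def mu_def
    by (subst nn_integral_density)
      (auto simp: case_prod_beta'
        intro: measurable_compose[OF _ measurable_ennreal] measurable_completion[OF borel_measurable_mu_density] measurable_completion)
  moreover have "ennreal (1 / norm (fst z - snd z) ^ DIM('a)) * ennreal (young_primitive g \<bar>Ds s u z\<bar>) =
      ennreal (1 / norm (fst z - snd z) ^ DIM('a) * young_primitive g \<bar>Ds s u z\<bar>)" for z
    by (intro ennreal_mult[symmetric] young_primitive_nonneg[OF g]) simp
  ultimately show ?thesis
    by (simp only: nn_integral_completion lborel_prod)
qed

section \<open>Mean-zero functions on a cubical partition\<close>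

text \<open>Restriction to \<open>Basis\<close> makes indices extensional, so that those of a
  bounded set lie in a finite \<open>PiE\<close>.\<close>

definition cell_index :: "nat \<Rightarrow> 'a::euclidean_space \<Rightarrow> 'a \<Rightarrow> int" where
  "cell_index N x = (\<lambda>b\<in>Basis. \<lfloor>real N * (x \<bullet> b)\<rfloor>)"

text \<open>For N > 0 the nonempty cells are half-open cubes of side 1 / N; as fibres of
  \<open>cell_index\<close> they are disjoint.\<close>

definition cell :: "nat \<Rightarrow> ('a \<Rightarrow> int) \<Rightarrow> 'a::euclidean_space set" where
  "cell N z = {x. cell_index N x = z}"

lemma cell_index_mem_cell [simp]: "x \<in> cell N (cell_index N x)"
  by (simp add: cell_def)

lemma mem_cell_iff: "x \<in> cell N (cell_index N y) \<longleftrightarrow> (\<forall>b\<in>Basis. \<lfloor>real N * (x \<bullet> b)\<rfloor> = \<lfloor>real N * (y \<bullet> b)\<rfloor>)"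
  by (auto simp: cell_def cell_index_def fun_eq_iff restrict_def)

lemma cell_borel [measurable]: "cell N (cell_index N y) \<in> sets borel"
proof -
  have "cell N (cell_index N y) = {x \<in> space borel. \<forall>b\<in>Basis. \<lfloor>real N * (x \<bullet> b)\<rfloor> = \<lfloor>real N * (y \<bullet> b)\<rfloor>}"
    by (auto simp: mem_cell_iff)
  also have "\<dots> \<in> sets borel"
    by measurable
  finally show ?thesis .
qed

lemma norm_diff_cell_le:
  fixes x x' :: "'a::euclidean_space"
  assumes "0 < N" "x \<in> cell N z" "x' \<in> cell N z"
  shows "norm (x - x') \<le> real DIM('a) / real N"
proof -
  have "x' \<in> cell N (cell_index N x)"
    using assms by (simp add: cell_def)
  then have floor_eq: "\<lfloor>real N * (x' \<bullet> b)\<rfloor> = \<lfloor>real N * (x \<bullet> b)\<rfloor>" if "b \<in> Basis" for b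
    using that by (simp add: mem_cell_iff)
  have "\<bar>real N * (x \<bullet> b) - real N * (x' \<bullet> b)\<bar> \<le> 1" if "b \<in> Basis" for b
    using floor_eq[OF that] floor_correct[of "real N * (x \<bullet> b)"] floor_correct[of "real N * (x' \<bullet> b)"]
    by linarith
  then have "real N * \<bar>(x - x') \<bullet> b\<bar> \<le> 1" if "b \<in> Basis" for b
    using that by (simp add: inner_diff_left abs_mult flip: right_diff_distrib)
  then have "\<bar>(x - x') \<bullet> b\<bar> \<le> 1 / real N" if "b \<in> Basis" for b
    using that \<open>0 < N\<close> by (simp add: field_simps)
  then have "(\<Sum>b\<in>Basis. \<bar>(x - x') \<bullet> b\<bar>) \<le> (\<Sum>b\<in>(Basis::'a set). 1 / real N)"
    by (intro sum_mono)
  then show ?thesis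
    using norm_le_l1[of "x - x'"] by simp
qed

text \<open>The cell lies between the open and the closed box with the same corners, whose volumes
  agree.\<close>

lemma cell_emeasure:
  fixes y :: "'a::euclidean_space"
  assumes "0 < N"
  shows "emeasure lborel (cell N (cell_index N y)) = ennreal ((1 / real N) ^ DIM('a))"
proof -
  define l where "l = (\<Sum>b\<in>Basis. (real_of_int \<lfloor>real N * (y \<bullet> b)\<rfloor> / real N) *\<^sub>R b)"
  define u where "u = (\<Sum>b\<in>Basis. ((real_of_int \<lfloor>real N * (y \<bullet> b)\<rfloor> + 1) / real N) *\<^sub>R b)"
  have lu: "l \<bullet> b = real_of_int \<lfloor>real N * (y \<bullet> b)\<rfloor> / real N"
    "u \<bullet> b = (real_of_int \<lfloor>real N * (y \<bullet> b)\<rfloor> + 1) / real N" if "b \<in> Basis" for b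
    using that by (simp_all add: l_def u_def)
  have le: "l \<bullet> b \<le> u \<bullet> b" if "b \<in> Basis" for b
    using that by (simp add: lu divide_right_mono)
  have prod: "(\<Prod>b\<in>Basis. (u - l) \<bullet> b) = (1 / real N) ^ DIM('a)"
    by (simp add: lu inner_diff_left flip: diff_divide_distrib)
  have "box l u \<subseteq> cell N (cell_index N y)"
    using \<open>0 < N\<close> by (auto simp: mem_box mem_cell_iff lu field_simps floor_eq_iff) (meson less_imp_le)
  moreover have "cell N (cell_index N y) \<subseteq> cbox l u"
    using \<open>0 < N\<close> by (auto simp: mem_box mem_cell_iff lu field_simps floor_eq_iff) (meson less_imp_le)
  ultimately have "emeasure lborel (box l u) \<le> emeasure lborel (cell N (cell_index N y))"
    "emeasure lborel (cell N (cell_index N y)) \<le> emeasure lborel (cbox l u)"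
    by (auto intro!: emeasure_mono)
  then show ?thesis
    by (simp add: le prod)
qed

lemma finite_cell_index_image:
  assumes "bounded S"
  shows "finite (cell_index N ` (S :: 'a::euclidean_space set))"
proof -
  obtain B where B: "\<And>x. x \<in> S \<Longrightarrow> norm x \<le> B"
    using assms by (auto simp: bounded_iff)
  define K where "K = \<lceil>real N * B\<rceil> + 1"
  have "cell_index N x \<in> Pi\<^sub>E Basis (\<lambda>_. {-K..K})" if "x \<in> S" for x
  proof (rule PiE_I)
    fix b :: 'a assume b: "b \<in> Basis"
    have "\<bar>x \<bullet> b\<bar> \<le> B"
      using Basis_le_norm[OF b, of x] B[OF that] by simp
    then have "real N * \<bar>x \<bullet> b\<bar> \<le> real N * B"
      by (intro mult_left_mono) auto
    then have "\<bar>real N * (x \<bullet> b)\<bar> \<le> real N * B"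
      by (simp add: abs_mult)
    then have "-K \<le> \<lfloor>real N * (x \<bullet> b)\<rfloor>" "\<lfloor>real N * (x \<bullet> b)\<rfloor> \<le> K"
      unfolding K_def by linarith+
    then show "cell_index N x b \<in> {-K..K}"
      using b by (simp add: cell_index_def)
  qed (simp add: cell_index_def)
  then have "cell_index N ` S \<subseteq> Pi\<^sub>E Basis (\<lambda>_. {-K..K})"
    by blast
  then show ?thesis
    by (rule finite_subset) (simp add: finite_PiE)
qed

lemma modular_I_eq_lborel:
  "\<Omega> \<in> sets borel \<Longrightarrow> modular_I g \<Omega> u = (\<integral>\<^sup>+x\<in>\<Omega>. ennreal (young_primitive g \<bar>u x\<bar>) \<partial>lborel)"
  by (simp add: modular_I_def nn_integral_completion)

text \<open>A Poincare inequality whose constant decays like N^(-s): on each cell Jensen's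
  inequality yields differences, the small diameter turns them into energy, and the squares of
  distinct cells do not overlap.\<close>

lemma modular_I_le_modular_J_if_cell_means_zero:
  fixes u :: "'a::euclidean_space \<Rightarrow> real"
  assumes g: "young_density g" and "0 < s" and \<Omega>: "\<Omega> \<in> sets borel" "bounded \<Omega>" and N: "DIM('a) \<le> N"
    and u: "u \<in> borel_measurable lebesgue"
    and int: "\<And>y. set_integrable lebesgue (cell N (cell_index N y)) u"
    and mean: "\<And>y. y \<in> \<Omega> \<Longrightarrow> (LINT x:cell N (cell_index N y)|lebesgue. u x) = 0"
  shows "modular_I g \<Omega> u
    \<le> ennreal (real DIM('a) ^ DIM('a) * (real DIM('a) / real N) powr s) * modular_J g s u"
proof -
  obtain u' where u' [measurable]: "u' \<in> borel_measurable lborel" and ae: "AE x in lebesgue. u x = u' x"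
    using u by (rule lebesgue_borel_representative)
  have ae_lborel: "AE x in lborel. u x = u' x"
    using ae by (simp add: AE_completion_iff)
  have "0 < N"
    using N DIM_positive[where 'a='a] by linarith
  \<comment> \<open>A bound for the diameter of a cell; N \<ge> DIM('a) makes it at most 1, as the
    energy estimate demands.\<close>
  define d where "d = real DIM('a) / real N"
  have "0 < d" "d \<le> 1"
    using N \<open>0 < N\<close> by (auto simp: d_def)
  define q where "q = (1 / real N) ^ DIM('a)"
  define Z where "Z = (cell_index N :: 'a \<Rightarrow> _) ` \<Omega>"
  have "finite Z"
    unfolding Z_def by (rule finite_cell_index_image[OF \<Omega>(2)])
  define G where "G = young_primitive g"
  have G [measurable]: "G \<in> borel_measurable borel"
    unfolding G_def by (rule borel_measurable_young_primitive[OF g])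
  have Z_borel [measurable]: "cell N z \<in> sets borel" if "z \<in> Z" for z
    using that by (auto simp: Z_def)
  define e where "e p = 1 / norm (fst p - snd p) ^ DIM('a) * G \<bar>Ds s u' p\<bar>" for p :: "'a \<times> 'a"
  have e_nonneg: "0 \<le> e p" for p
    by (simp add: e_def G_def young_primitive_nonneg[OF g])
  have e_meas [measurable]: "e \<in> borel_measurable (lborel \<Otimes>\<^sub>M lborel)"
    using borel_measurable_Ds_lborel[OF u'] borel_measurable_mu_density
    unfolding e_def lborel_prod by measurable
  \<comment> \<open>Here q is the volume of the cell, so this is Jensen's inequality at each x,
    integrated over x in the same cell.\<close>
  have cell_bound: "ennreal q * (\<integral>\<^sup>+x\<in>cell N z. ennreal (G \<bar>u' x\<bar>) \<partial>lborel)
      \<le> (\<integral>\<^sup>+p. ennreal (d powr s * d ^ DIM('a) * e p) * indicator (cell N z \<times> cell N z) p \<partial>(lborel \<Otimes>\<^sub>M lborel))"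
    (is "?L \<le> ?R") if z: "z \<in> Z" for z
  proof -
    note Z_borel[OF z, measurable]
    obtain y where y: "y \<in> \<Omega>" "z = cell_index N y"
      using z by (auto simp: Z_def)
    have em: "emeasure lborel (cell N z) = ennreal q"
      unfolding y(2) q_def by (rule cell_emeasure[OF \<open>0 < N\<close>])
    then have meas: "measure lborel (cell N z) = q"
      by (simp add: measure_def q_def)
    have "set_integrable lebesgue (cell N z) u' \<longleftrightarrow> set_integrable lebesgue (cell N z) u"
      using ae u u' z
      by (intro set_integrable_cong_AE) (auto intro: measurable_completion)
    then have int': "set_integrable lborel (cell N z) u'"
      using int[of y] u' Z_borel[OF z]
      by (simp add: y(2) set_integrable_def integrable_completion)
    have "(LINT x:cell N z|lborel. u' x) = (LINT x:cell N z|lebesgue. u' x)"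
      using u' Z_borel[OF z] by (simp add: set_lebesgue_integral_def integral_completion)
    also have "\<dots> = (LINT x:cell N z|lebesgue. u x)"
      using ae u u' Z_borel[OF z] by (intro set_lebesgue_integral_cong_AE) (auto intro: measurable_completion)
    also have "\<dots> = 0"
      unfolding y(2) by (rule mean[OF y(1)])
    finally have mean': "(LINT x:cell N z|lborel. u' x) = 0" .
    have "?L = (\<integral>\<^sup>+x\<in>cell N z. ennreal q * ennreal (G \<bar>u' x\<bar>) \<partial>lborel)"
      by (subst nn_integral_cmult[symmetric]) (auto simp: mult.assoc)
    also have "\<dots> \<le> (\<integral>\<^sup>+x\<in>cell N z. (\<integral>\<^sup>+y\<in>cell N z. ennreal (G \<bar>u' x - u' y\<bar>) \<partial>lborel) \<partial>lborel)"
      using young_primitive_mean_zero_le[OF g _ _ int' mean'] em meas Z_borel[OF z]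
      by (intro nn_integral_mono mult_right_mono) (auto simp: G_def)
    also have "\<dots> = (\<integral>\<^sup>+x. \<integral>\<^sup>+y. ennreal (G \<bar>u' x - u' y\<bar>) * indicator (cell N z \<times> cell N z) (x, y) \<partial>lborel \<partial>lborel)"
      by (subst nn_integral_multc[symmetric]) (auto simp: indicator_times mult_ac)
    also have "\<dots> \<le> (\<integral>\<^sup>+x. \<integral>\<^sup>+y. ennreal (d powr s * d ^ DIM('a) * e (x, y)) * indicator (cell N z \<times> cell N z) (x, y) \<partial>lborel \<partial>lborel)"
    proof (intro nn_integral_mono)
      fix x x' :: 'a
      have "G \<bar>u' x - u' x'\<bar> \<le> d powr s * d ^ DIM('a) * e (x, x')" if "x \<in> cell N z" "x' \<in> cell N z"
        using young_primitive_diff_le_energy_density[OF g \<open>0 < s\<close> _ \<open>d \<le> 1\<close>]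
          norm_diff_cell_le[OF \<open>0 < N\<close> that] by (simp add: G_def e_def d_def)
      then show "ennreal (G \<bar>u' x - u' x'\<bar>) * indicator (cell N z \<times> cell N z) (x, x')
          \<le> ennreal (d powr s * d ^ DIM('a) * e (x, x')) * indicator (cell N z \<times> cell N z) (x, x')"
        by (auto simp: indicator_def intro!: ennreal_leI)
    qed
    also have "\<dots> = ?R"
      by (rule lborel.nn_integral_fst) measurable
    finally show ?thesis .
  qed
  have "modular_I g \<Omega> u = (\<integral>\<^sup>+x\<in>\<Omega>. ennreal (G \<bar>u' x\<bar>) \<partial>lborel)"
    unfolding modular_I_eq_lborel[OF \<Omega>(1)] G_def
    using ae_lborel by (intro nn_integral_cong_AE) (auto elim!: eventually_mono)
  also have "\<dots> \<le> (\<integral>\<^sup>+x. (\<Sum>z\<in>Z. ennreal (G \<bar>u' x\<bar>) * indicator (cell N z) x) \<partial>lborel)"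
  proof (rule nn_integral_mono)
    fix x
    have "ennreal (G \<bar>u' x\<bar>) * indicator (cell N (cell_index N x)) x
        \<le> (\<Sum>z\<in>Z. ennreal (G \<bar>u' x\<bar>) * indicator (cell N z) x)" if "x \<in> \<Omega>"
      using that \<open>finite Z\<close> by (intro member_le_sum) (auto simp: Z_def)
    then show "ennreal (G \<bar>u' x\<bar>) * indicator \<Omega> x \<le> (\<Sum>z\<in>Z. ennreal (G \<bar>u' x\<bar>) * indicator (cell N z) x)"
      by (cases "x \<in> \<Omega>") auto
  qed
  also have "\<dots> = (\<Sum>z\<in>Z. \<integral>\<^sup>+x\<in>cell N z. ennreal (G \<bar>u' x\<bar>) \<partial>lborel)"
    by (rule nn_integral_sum) measurable
  finally have "ennreal q * modular_I g \<Omega> u \<le> (\<Sum>z\<in>Z. ennreal q * (\<integral>\<^sup>+x\<in>cell N z. ennreal (G \<bar>u' x\<bar>) \<partial>lborel))"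
    unfolding sum_distrib_left[symmetric] by (rule mult_left_mono) simp
  also have "\<dots> \<le> (\<Sum>z\<in>Z. \<integral>\<^sup>+p. ennreal (d powr s * d ^ DIM('a) * e p) * indicator (cell N z \<times> cell N z) p \<partial>(lborel \<Otimes>\<^sub>M lborel))"
    by (intro sum_mono cell_bound)
  also have "\<dots> = (\<integral>\<^sup>+p. (\<Sum>z\<in>Z. ennreal (d powr s * d ^ DIM('a) * e p) * indicator (cell N z \<times> cell N z) p) \<partial>(lborel \<Otimes>\<^sub>M lborel))"
    by (rule nn_integral_sum[symmetric]) measurable
  also have "\<dots> \<le> (\<integral>\<^sup>+p. ennreal (d powr s * d ^ DIM('a)) * ennreal (e p) \<partial>(lborel \<Otimes>\<^sub>M lborel))"
  proof (rule nn_integral_mono)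
    fix p :: "'a \<times> 'a"
    \<comment> \<open>A pair lies in the square of at most one cell, the one containing its first
      component.\<close>
    have "(\<Sum>z\<in>Z. indicator (cell N z \<times> cell N z) p) \<le> (\<Sum>z\<in>Z. if z = cell_index N (fst p) then 1 else (0::ennreal))"
      by (intro sum_mono) (auto simp: cell_def indicator_def)
    also have "\<dots> \<le> 1"
      using \<open>finite Z\<close> by simp
    finally have "ennreal (d powr s * d ^ DIM('a) * e p) * (\<Sum>z\<in>Z. indicator (cell N z \<times> cell N z) p)
        \<le> ennreal (d powr s * d ^ DIM('a) * e p) * 1"
      by (rule mult_left_mono) simp
    then show "(\<Sum>z\<in>Z. ennreal (d powr s * d ^ DIM('a) * e p) * indicator (cell N z \<times> cell N z) p)
        \<le> ennreal (d powr s * d ^ DIM('a)) * ennreal (e p)"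
      using \<open>0 < d\<close> e_nonneg[of p] by (simp add: sum_distrib_left ennreal_mult')
  qed
  also have "\<dots> = ennreal (d powr s * d ^ DIM('a)) * (\<integral>\<^sup>+p. ennreal (e p) \<partial>(lborel \<Otimes>\<^sub>M lborel))"
    by (rule nn_integral_cmult) measurable
  also have "(\<integral>\<^sup>+p. ennreal (e p) \<partial>(lborel \<Otimes>\<^sub>M lborel)) = modular_J g s u"
    unfolding modular_J_cong_AE[OF ae] modular_J_lborel[OF g u'] e_def G_def ..
  finally have main: "ennreal q * modular_I g \<Omega> u \<le> ennreal (d powr s * d ^ DIM('a)) * modular_J g s u" .
  \<comment> \<open>Division by q multiplies by N^n; since N d = n, the factor N^n d^n becomes the
    n^n of the statement.\<close>
  have "modular_I g \<Omega> u = ennreal (real N ^ DIM('a)) * (ennreal q * modular_I g \<Omega> u)"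
    using \<open>0 < N\<close> by (simp add: q_def power_divide mult.assoc[symmetric] ennreal_mult'[symmetric])
  also have "\<dots> \<le> ennreal (real N ^ DIM('a)) * (ennreal (d powr s * d ^ DIM('a)) * modular_J g s u)"
    by (rule mult_left_mono[OF main]) simp
  also have "\<dots> = ennreal (real DIM('a) ^ DIM('a) * d powr s) * modular_J g s u"
    using \<open>0 < N\<close> by (simp add: mult.assoc[symmetric] ennreal_mult'[symmetric])
      (simp add: d_def power_divide mult_ac)
  finally show ?thesis
    by (simp add: d_def)
qed

section \<open>Growth of the minimax levels\<close>

lemma W0_D:
  assumes "u \<in> W0 g s \<Omega>"
  shows "u \<in> borel_measurable lebesgue" "modular_I g UNIV u < \<infinity>" "modular_J g s u < \<infinity>"
    "AE x in lebesgue. x \<notin> \<Omega> \<longrightarrow> u x = 0"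
  using assms by (auto simp: W0_def)

section \<open>Continuity of the means in the norm\<close>

lemma borel_measurable_young_primitive_abs:
  assumes "young_density g" "f \<in> borel_measurable M"
  shows "(\<lambda>x. young_primitive g \<bar>f x\<bar>) \<in> borel_measurable M"
proof -
  note [measurable] = borel_measurable_young_primitive[OF assms(1)] assms(2)
  show ?thesis
    by measurable
qed

lemma W0_set_integrable:
  assumes g: "young_density g" and u: "u \<in> W0 g s \<Omega>"
    and A: "A \<in> sets borel" "emeasure lborel A < \<infinity>"
  shows "set_integrable lebesgue A u"
proof -
  have G: "(\<lambda>x. young_primitive g \<bar>u x\<bar>) \<in> borel_measurable lebesgue"
    by (rule borel_measurable_young_primitive_abs[OF g W0_D(1)[OF u]])
  have "integrable lebesgue (\<lambda>x. young_primitive g \<bar>u x\<bar>)"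
    using W0_D(2)[OF u] G young_primitive_nonneg[OF g]
    by (intro integrableI_nonneg) (auto simp: modular_I_def)
  moreover have "integrable lebesgue (\<lambda>x. indicator A x :: real)"
    using A by simp
  ultimately have "integrable lebesgue (\<lambda>x. indicator A x + young_primitive g \<bar>u x\<bar> / young_primitive g 1)"
    by (intro Bochner_Integration.integrable_add integrable_divide)
  then show ?thesis
    unfolding set_integrable_def
  proof (rule Bochner_Integration.integrable_bound)
    show "(\<lambda>x. indicator A x *\<^sub>R u x) \<in> borel_measurable lebesgue"
      using A(1) W0_D(1)[OF u] by (intro borel_measurable_scaleR borel_measurable_indicator) auto
    show "AE x in lebesgue. norm (indicator A x *\<^sub>R u x)
        \<le> norm (indicator A x + young_primitive g \<bar>u x\<bar> / young_primitive g 1)"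
      using young_primitive_linear_bound[OF g, of "\<bar>u x\<bar>" for x] young_primitive_nonneg[OF g]
      by (auto simp: indicator_def)
  qed
qed

text \<open>The linear bound applied to u / c is integrated over \<Omega>, which carries u; hence
  the constant does not depend on A.\<close>

lemma abs_set_integral_le_modular:
  fixes u :: "'a::euclidean_space \<Rightarrow> real"
  assumes g: "young_density g" and u: "u \<in> borel_measurable lebesgue"
    and int: "set_integrable lebesgue A u"
    and \<Omega>: "\<Omega> \<in> sets borel" "emeasure lborel \<Omega> < \<infinity>" and supp: "AE x in lebesgue. x \<notin> \<Omega> \<longrightarrow> u x = 0"
    and c: "0 < c" "modular_I g \<Omega> (\<lambda>x. u x / c) \<le> 1"
  shows "\<bar>LINT x:A|lebesgue. u x\<bar> \<le> c * (measure lborel \<Omega> + 1 / young_primitive g 1)"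
proof -
  define k where "k = 1 / young_primitive g 1"
  have "0 < k"
    using young_primitive_pos[OF g, of 1] by (simp add: k_def)
  have G: "(\<lambda>x. ennreal (young_primitive g \<bar>u x / c\<bar>)) \<in> borel_measurable lebesgue"
    using u by (intro measurable_compose[OF borel_measurable_young_primitive_abs[OF g] measurable_ennreal]) auto
  have \<Omega>_meas: "(indicator \<Omega> :: 'a \<Rightarrow> ennreal) \<in> borel_measurable lebesgue"
    using \<Omega>(1) by (intro borel_measurable_indicator) auto
  have "ennreal \<bar>LINT x:A|lebesgue. u x\<bar> \<le> (\<integral>\<^sup>+x. ennreal (norm (indicator A x *\<^sub>R u x)) \<partial>lebesgue)"
    using integral_norm_bound_ennreal[OF int[unfolded set_integrable_def]]
    by (simp add: set_lebesgue_integral_def)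
  also have "\<dots> \<le> (\<integral>\<^sup>+x. ennreal c * (indicator \<Omega> x + ennreal k * (ennreal (young_primitive g \<bar>u x / c\<bar>) * indicator \<Omega> x)) \<partial>lebesgue)"
  proof (rule nn_integral_mono_AE, use supp in eventually_elim)
    fix x assume x: "x \<notin> \<Omega> \<longrightarrow> u x = 0"
    have "\<bar>u x\<bar> / c \<le> 1 + k * young_primitive g \<bar>u x / c\<bar>"
      using young_primitive_linear_bound[OF g, of "\<bar>u x / c\<bar>"] c(1) by (simp add: k_def)
    then have "\<bar>u x\<bar> \<le> c * (1 + k * young_primitive g \<bar>u x / c\<bar>)"
      using c(1) by (simp add: field_simps)
    then have "ennreal \<bar>u x\<bar> \<le> ennreal c * (1 + ennreal k * ennreal (young_primitive g \<bar>u x / c\<bar>))"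
      using c(1) \<open>0 < k\<close> young_primitive_nonneg[OF g, of "\<bar>u x / c\<bar>"]
      by (simp add: ennreal_mult'[symmetric] ennreal_1[symmetric] ennreal_plus[symmetric] del: ennreal_1 ennreal_plus)
    then show "ennreal (norm (indicator A x *\<^sub>R u x))
        \<le> ennreal c * (indicator \<Omega> x + ennreal k * (ennreal (young_primitive g \<bar>u x / c\<bar>) * indicator \<Omega> x))"
      using x by (auto simp: indicator_def)
  qed
  also have "\<dots> = ennreal c * (emeasure lborel \<Omega> + ennreal k * modular_I g \<Omega> (\<lambda>x. u x / c))"
    using G \<Omega>_meas \<Omega>(1)
    by (simp add: nn_integral_cmult nn_integral_add modular_I_def borel_measurable_times)
  also have "\<dots> \<le> ennreal c * (ennreal (measure lborel \<Omega>) + ennreal k * 1)"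
    using c(2) \<Omega>(2) by (intro mult_left_mono add_mono) (auto simp: emeasure_eq_ennreal_measure less_top)
  also have "\<dots> = ennreal (c * (measure lborel \<Omega> + k))"
    using c(1) \<open>0 < k\<close> by (simp add: ennreal_mult' ennreal_plus)
  finally show ?thesis
    using c(1) \<open>0 < k\<close> by (simp add: k_def)
qed

text \<open>Shows that the infima in the norm of a difference range over nonempty sets.\<close>

lemma young_modular_diff_scaled_le_1:
  fixes f h :: "'a \<Rightarrow> real"
  assumes g: "young_density g" and f: "f \<in> borel_measurable M" "h \<in> borel_measurable M"
    and fin: "(\<integral>\<^sup>+x. ennreal (young_primitive g \<bar>f x\<bar>) \<partial>M) < \<infinity>"
      "(\<integral>\<^sup>+x. ennreal (young_primitive g \<bar>h x\<bar>) \<partial>M) < \<infinity>"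
  obtains c where "0 < c" "(\<integral>\<^sup>+x. ennreal (young_primitive g \<bar>(f x - h x) / c\<bar>) \<partial>M) \<le> 1"
proof -
  define a where "a = enn2real (\<integral>\<^sup>+x. ennreal (young_primitive g \<bar>f x\<bar>) \<partial>M)"
  define b where "b = enn2real (\<integral>\<^sup>+x. ennreal (young_primitive g \<bar>h x\<bar>) \<partial>M)"
  have ab: "0 \<le> a" "0 \<le> b" "(\<integral>\<^sup>+x. ennreal (young_primitive g \<bar>f x\<bar>) \<partial>M) = ennreal a"
    "(\<integral>\<^sup>+x. ennreal (young_primitive g \<bar>h x\<bar>) \<partial>M) = ennreal b"
    using fin by (auto simp: a_def b_def less_top)
  \<comment> \<open>Makes (2 / c) (a + b) at most 1 and c at least 2.\<close>
  define c where "c = 2 * (1 + a + b)"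
  have "2 \<le> c"
    using ab by (simp add: c_def)
  have meas: "(\<lambda>x. ennreal (young_primitive g \<bar>f x\<bar>)) \<in> borel_measurable M"
    "(\<lambda>x. ennreal (young_primitive g \<bar>h x\<bar>)) \<in> borel_measurable M"
    using borel_measurable_young_primitive_abs[OF g f(1)] borel_measurable_young_primitive_abs[OF g f(2)]
    by simp_all
  have "(\<integral>\<^sup>+x. ennreal (young_primitive g \<bar>(f x - h x) / c\<bar>) \<partial>M)
      \<le> (\<integral>\<^sup>+x. ennreal (2 / c) * (ennreal (young_primitive g \<bar>f x\<bar>) + ennreal (young_primitive g \<bar>h x\<bar>)) \<partial>M)"
  proof (rule nn_integral_mono)
    fix x
    have "ennreal (young_primitive g \<bar>(f x - h x) / c\<bar>)
        \<le> ennreal ((2 / c) * (young_primitive g \<bar>f x\<bar> + young_primitive g \<bar>h x\<bar>))"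
      using young_primitive_add_scale_le[OF g \<open>2 \<le> c\<close>, of "f x" "h x"] \<open>2 \<le> c\<close> by (intro ennreal_leI) simp
    also have "\<dots> = ennreal (2 / c) * (ennreal (young_primitive g \<bar>f x\<bar>) + ennreal (young_primitive g \<bar>h x\<bar>))"
      using \<open>2 \<le> c\<close> by (subst ennreal_mult') (auto simp: ennreal_plus young_primitive_nonneg[OF g])
    finally show "ennreal (young_primitive g \<bar>(f x - h x) / c\<bar>)
        \<le> ennreal (2 / c) * (ennreal (young_primitive g \<bar>f x\<bar>) + ennreal (young_primitive g \<bar>h x\<bar>))" .
  qed
  also have "\<dots> = ennreal (2 / c) * (ennreal a + ennreal b)"
    using meas by (simp add: nn_integral_cmult nn_integral_add ab)
  also have "\<dots> = ennreal ((2 / c) * (a + b))"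
    using ab \<open>2 \<le> c\<close> by (subst ennreal_mult') (auto simp: ennreal_plus)
  also have "\<dots> \<le> ennreal 1"
    using ab by (intro ennreal_leI) (auto simp: c_def field_simps)
  finally show ?thesis
    using that[of c] \<open>2 \<le> c\<close> by simp
qed

lemma Ds_scaled_diff: "Ds s (\<lambda>x. (u x - v x) / c) z = (Ds s u z - Ds s v z) / c"
  by (cases z) (simp add: Ds_def diff_divide_distrib mult.commute)

text \<open>Every scale c admissible for the Luxemburg norm bounds the left-hand side by c times the
  constant, hence so does their infimum; the seminorm part of the norm only adds a non-negative
  term.\<close>

lemma abs_set_integral_diff_le_W0_norm:
  fixes u v :: "'a::euclidean_space \<Rightarrow> real"
  assumes g: "young_density g" and u: "u \<in> W0 g s \<Omega>" and v: "v \<in> W0 g s \<Omega>"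
    and A: "A \<in> sets borel" "emeasure lborel A < \<infinity>"
    and \<Omega>: "\<Omega> \<in> sets borel" "emeasure lborel \<Omega> < \<infinity>"
  shows "\<bar>(LINT x:A|lebesgue. u x) - (LINT x:A|lebesgue. v x)\<bar>
    \<le> (measure lborel \<Omega> + 1 / young_primitive g 1) * W0_norm g s \<Omega> (\<lambda>x. u x - v x)"
proof -
  define K where "K = measure lborel \<Omega> + 1 / young_primitive g 1"
  have "0 < K"
    using young_primitive_pos[OF g, of 1] by (simp add: K_def add_nonneg_pos)
  define S where "S = {c. c > 0 \<and> modular_I g \<Omega> (\<lambda>x. (u x - v x) / c) \<le> 1}"
  define T where "T = {c. c > 0 \<and> modular_J g s (\<lambda>x. (u x - v x) / c) \<le> 1}"
  have int: "set_integrable lebesgue A u" "set_integrable lebesgue A v"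
    using W0_set_integrable[OF g _ A] u v by auto
  have "S \<noteq> {}"
  proof -
    obtain c where c: "0 < c" "(\<integral>\<^sup>+x. ennreal (young_primitive g \<bar>(u x - v x) / c\<bar>) \<partial>lebesgue) \<le> 1"
      using young_modular_diff_scaled_le_1[OF g W0_D(1)[OF u] W0_D(1)[OF v]] W0_D(2)[OF u] W0_D(2)[OF v]
      by (auto simp: modular_I_def)
    have "modular_I g \<Omega> (\<lambda>x. (u x - v x) / c) \<le> (\<integral>\<^sup>+x. ennreal (young_primitive g \<bar>(u x - v x) / c\<bar>) \<partial>lebesgue)"
      unfolding modular_I_def by (intro nn_integral_mono) (auto simp: indicator_def)
    with c have "c \<in> S"
      by (auto simp: S_def)
    then show ?thesis
      by blast
  qed
  \<comment> \<open>The real infimum of an empty set has no useful value, so nonemptiness is what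
    makes the seminorm part non-negative.\<close>
  have "T \<noteq> {}"
  proof -
    obtain c where "0 < c" "(\<integral>\<^sup>+z. ennreal (young_primitive g \<bar>(Ds s u z - Ds s v z) / c\<bar>) \<partial>mu) \<le> 1"
      using young_modular_diff_scaled_le_1[OF g borel_measurable_Ds_mu[OF W0_D(1)[OF u], of s]
          borel_measurable_Ds_mu[OF W0_D(1)[OF v], of s]] W0_D(3)[OF u] W0_D(3)[OF v]
      by (auto simp: modular_J_def)
    then have "c \<in> T"
      by (simp add: T_def modular_J_def Ds_scaled_diff)
    then show ?thesis
      by blast
  qed
  then have "0 \<le> Inf T"
    by (intro cInf_greatest) (auto simp: T_def)
  have "\<bar>(LINT x:A|lebesgue. u x) - (LINT x:A|lebesgue. v x)\<bar> / K \<le> c" if "c \<in> S" for c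
  proof -
    have "AE x in lebesgue. x \<notin> \<Omega> \<longrightarrow> u x - v x = 0"
      using W0_D(4)[OF u] W0_D(4)[OF v] by eventually_elim auto
    moreover have "(\<lambda>x. u x - v x) \<in> borel_measurable lebesgue"
      using W0_D(1)[OF u] W0_D(1)[OF v] by simp
    ultimately have "\<bar>LINT x:A|lebesgue. u x - v x\<bar> \<le> c * K"
      using abs_set_integral_le_modular[OF g _ set_integral_diff(1)[OF int] \<Omega>] that
      by (simp add: S_def K_def)
    then show ?thesis
      using \<open>0 < K\<close> by (simp add: set_integral_diff(2)[OF int] field_simps)
  qed
  with \<open>S \<noteq> {}\<close> have "\<bar>(LINT x:A|lebesgue. u x) - (LINT x:A|lebesgue. v x)\<bar> / K \<le> Inf S"
    by (intro cInf_greatest)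
  also have "\<dots> \<le> W0_norm g s \<Omega> (\<lambda>x. u x - v x)"
    using \<open>0 \<le> Inf T\<close> by (simp add: W0_norm_def S_def T_def)
  finally show ?thesis
    using \<open>0 < K\<close> by (simp add: K_def[symmetric] field_simps)
qed

lemma odd_maps_set_integral_continuous:
  fixes \<Omega> :: "'a::euclidean_space set"
  assumes g: "young_density g" and h: "h \<in> odd_maps g s \<Omega> \<alpha> k"
    and A: "A \<in> sets borel" "emeasure lborel A < \<infinity>"
    and \<Omega>: "\<Omega> \<in> sets borel" "emeasure lborel \<Omega> < \<infinity>"
  shows "continuous_on (sph (k - 1)) (\<lambda>w. LINT x:A|lebesgue. h w x)"
  unfolding continuous_on_def
proof
  fix w assume w: "w \<in> sph (k - 1)"
  define K where "K = measure lborel \<Omega> + 1 / young_primitive g 1"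
  have W0: "h w' \<in> W0 g s \<Omega>" if "w' \<in> sph (k - 1)" for w'
    using h that by (auto simp: odd_maps_def M_D_def topspace_nsphere_eq_sph)
  \<comment> \<open>Translates the abstract-topology filter of \<open>odd_maps\<close> into the one
    behind \<open>continuous_on\<close>.\<close>
  have "atin (nsphere (k - 1)) w = at w within sph (k - 1)"
    using w by (simp add: nsphere_eq_top_of_set atin_subtopology_within filter_eq_iff
        eventually_atin_within eventually_at_topological Bex_def) meson
  then have "((\<lambda>w'. W0_norm g s \<Omega> (\<lambda>x. h w' x - h w x)) \<longlongrightarrow> 0) (at w within sph (k - 1))"
    using h w by (auto simp: odd_maps_def topspace_nsphere_eq_sph)
  from tendsto_mult_right_zero[OF this, of K]
  have "((\<lambda>w'. (LINT x:A|lebesgue. h w' x) - (LINT x:A|lebesgue. h w x)) \<longlongrightarrow> 0) (at w within sph (k - 1))"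
    by (rule Lim_null_comparison[rotated])
      (auto simp: eventually_at_filter K_def intro!: always_eventually abs_set_integral_diff_le_W0_norm[OF g _ _ A \<Omega>] W0 w)
  then show "((\<lambda>w'. LINT x:A|lebesgue. h w' x) \<longlongrightarrow> (LINT x:A|lebesgue. h w x)) (at w within sph (k - 1))"
    by (subst Lim_null)
qed

text \<open>N is fixed first, so that the Poincare constant times the bound stays below \<alpha>.
  Once k exceeds the number of cells meeting \<Omega>, every admissible h takes a value all of whose
  means over these cells vanish.\<close>

lemma C_D_eventually_ge:
  fixes \<Omega> :: "'a::euclidean_space set"
  assumes g: "young_density g" and "0 < s" and \<Omega>: "open \<Omega>" "bounded \<Omega>" and "0 < \<alpha>"
  shows "eventually (\<lambda>k. ennreal B \<le> C_D g s \<Omega> \<alpha> k) sequentially"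
proof -
  have \<Omega>_borel: "\<Omega> \<in> sets borel" and \<Omega>_fin: "emeasure lborel \<Omega> < \<infinity>"
    using \<Omega> emeasure_bounded_finite by auto
  \<comment> \<open>Positive, so that it may be divided by.\<close>
  define B' where "B' = max 1 B"
  define n where "n = real DIM('a)"
  have "1 \<le> n"
    using DIM_positive[where 'a='a] unfolding n_def by linarith
  \<comment> \<open>The threshold for (n / N)^s at which the Poincare constant times
    \<open>B'\<close> equals \<alpha>.\<close>
  define e where "e = \<alpha> / (n ^ DIM('a) * B')"
  have "0 < e"
    using \<open>0 < \<alpha>\<close> \<open>1 \<le> n\<close> by (auto simp: e_def B'_def)
  \<comment> \<open>The first summand gives N \<ge> DIM('a), the second solves (n / N)^s < e for
    N.\<close>
  obtain N :: nat where N: "n + n / e powr (1 / s) < real N"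
    using reals_Archimedean2 by blast
  have "0 < n / e powr (1 / s)"
    using \<open>1 \<le> n\<close> \<open>0 < e\<close> by simp
  with N have N': "DIM('a) \<le> N" "n / e powr (1 / s) < real N"
    using \<open>1 \<le> n\<close> unfolding n_def by linarith+
  have "0 < N"
    using N' DIM_positive[where 'a='a] by linarith
  have "n / real N < e powr (1 / s)"
    using N'(2) \<open>0 < e\<close> \<open>0 < N\<close> by (simp add: field_simps)
  then have "(n / real N) powr s < (e powr (1 / s)) powr s"
    using \<open>0 < s\<close> \<open>1 \<le> n\<close> by (intro powr_less_mono2) auto
  also have "\<dots> = e"
    using \<open>0 < s\<close> \<open>0 < e\<close> by (simp add: powr_powr)
  finally have small: "n ^ DIM('a) * (n / real N) powr s * B' < \<alpha>"
    using \<open>1 \<le> n\<close> by (simp add: e_def B'_def field_simps)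
  define Z where "Z = cell_index N ` \<Omega>"
  have "finite Z"
    unfolding Z_def by (rule finite_cell_index_image[OF \<Omega>(2)])
  then obtain \<zeta> where \<zeta>: "bij_betw \<zeta> {0..<card Z} Z"
    using ex_bij_betw_nat_finite by blast
  \<comment> \<open>The sphere of R^k has dimension k - 1, so the strict inequality gives the
    \<open>card Z \<le> k - 1\<close> of Borsuk-Ulam.\<close>
  have "ennreal B \<le> C_D g s \<Omega> \<alpha> k" if k: "card Z < k" for k
    unfolding C_D_def
  proof (rule INF_greatest)
    fix h assume h: "h \<in> odd_maps g s \<Omega> \<alpha> k"
    have M: "h w \<in> W0 g s \<Omega>" "modular_I g \<Omega> (h w) = ennreal \<alpha>" if "w \<in> sph (k - 1)" for w
      using h that by (auto simp: odd_maps_def M_D_def topspace_nsphere_eq_sph)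
    have cell_borel': "cell N (\<zeta> i) \<in> sets borel" and cell_fin: "emeasure lborel (cell N (\<zeta> i)) < \<infinity>"
      if "i < card Z" for i
    proof -
      have "\<zeta> i \<in> Z"
        using \<zeta> that by (auto simp: bij_betw_def)
      then show "cell N (\<zeta> i) \<in> sets borel" "emeasure lborel (cell N (\<zeta> i)) < \<infinity>"
        using cell_emeasure[OF \<open>0 < N\<close>, where 'a='a] by (auto simp: Z_def)
    qed
    obtain w where w: "w \<in> sph (k - 1)" "\<And>i. i < card Z \<Longrightarrow> (LINT x:cell N (\<zeta> i)|lebesgue. h w x) = 0"
    proof (rule Borsuk_Ulam_nsphere[of "card Z" "k - 1" "\<lambda>w i. LINT x:cell N (\<zeta> i)|lebesgue. h w x"])
      show "continuous_on (sph (k - 1)) (\<lambda>w. LINT x:cell N (\<zeta> i)|lebesgue. h w x)" if "i < card Z" for i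
        by (rule odd_maps_set_integral_continuous[OF g h cell_borel'[OF that] cell_fin[OF that] \<Omega>_borel \<Omega>_fin])
      show "(LINT x:cell N (\<zeta> i)|lebesgue. h (\<lambda>j. - w j) x) = - (LINT x:cell N (\<zeta> i)|lebesgue. h w x)"
        if w: "w \<in> sph (k - 1)" and i: "i < card Z" for w i
      proof -
        have "AE x in lebesgue. h (\<lambda>i. - w i) x = - h w x"
          using h w by (auto simp: odd_maps_def topspace_nsphere_eq_sph)
        then have "(LINT x:cell N (\<zeta> i)|lebesgue. h (\<lambda>j. - w j) x) = (LINT x:cell N (\<zeta> i)|lebesgue. - h w x)"
          using cell_borel'[OF i] W0_D(1)[OF M(1)[OF w]] W0_D(1)[OF M(1)[OF sph_minus[OF w]]]
          by (intro set_lebesgue_integral_cong_AE) auto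
        then show ?thesis
          by (simp add: set_lebesgue_integral_def)
      qed
      show "card Z \<le> k - 1"
        using k by simp
    qed blast
    have mean: "(LINT x:cell N (cell_index N y)|lebesgue. h w x) = 0" if "y \<in> \<Omega>" for y
    proof -
      have "cell_index N y \<in> \<zeta> ` {0..<card Z}"
        using \<zeta> that by (auto simp: bij_betw_def Z_def)
      then show ?thesis
        using w(2) by auto
    qed
    have "ennreal \<alpha> \<le> ennreal (n ^ DIM('a) * (n / real N) powr s) * modular_J g s (h w)"
      unfolding n_def M(2)[OF w(1), symmetric]
    proof (rule modular_I_le_modular_J_if_cell_means_zero[OF g \<open>0 < s\<close> \<Omega>_borel \<Omega>(2) N'(1) W0_D(1)[OF M(1)[OF w(1)]] _ mean])
      show "set_integrable lebesgue (cell N (cell_index N y)) (h w)" for y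
        by (rule W0_set_integrable[OF g M(1)[OF w(1)]]) (simp_all add: cell_emeasure[OF \<open>0 < N\<close>])
    qed
    moreover have "ennreal (n ^ DIM('a) * (n / real N) powr s) * ennreal B' < ennreal \<alpha>"
      using small \<open>1 \<le> n\<close> \<open>0 < \<alpha>\<close> by (simp add: ennreal_mult'[symmetric] B'_def ennreal_lessI)
    ultimately have "\<not> modular_J g s (h w) \<le> ennreal B'"
      by (meson leD mult_left_mono order_trans zero_le)
    moreover have "ennreal B \<le> ennreal B'"
      by (intro ennreal_leI) (simp add: B'_def)
    ultimately have "ennreal B \<le> modular_J g s (h w)"
      by (meson linear order_trans)
    then show "ennreal B \<le> (SUP w\<in>topspace (sphere_Rk k). modular_J g s (h w))"
      using w(1) by (intro SUP_upper2) (auto simp: topspace_nsphere_eq_sph)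
  qed
  then show ?thesis
    unfolding eventually_sequentially by (intro exI[of _ "Suc (card Z)"]) auto
qed

section \<open>From energy to eigenvalues\<close>

lemma young_density_integral_bounds:
  fixes f :: "'a \<Rightarrow> real"
  assumes g: "young_density g"
    and G1: "\<And>t. 0 < t \<Longrightarrow> p \<le> t * g t / young_primitive g t \<and> t * g t / young_primitive g t \<le> q"
    and f: "f \<in> borel_measurable M" and fin: "(\<integral>\<^sup>+x. ennreal (young_primitive g \<bar>f x\<bar>) \<partial>M) = ennreal c" "0 \<le> c"
  shows "p * c \<le> (\<integral>x. signed_g g (f x) * f x \<partial>M)" "(\<integral>x. signed_g g (f x) * f x \<partial>M) \<le> q * c"
proof -
  have eq: "signed_g g t * t = g \<bar>t\<bar> * \<bar>t\<bar>" for t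
    by (auto simp: signed_g_def abs_if)
  \<comment> \<open>All terms vanish at t = 0; elsewhere (G_1) is multiplied by the positive
    primitive.\<close>
  have le: "p * young_primitive g \<bar>t\<bar> \<le> g \<bar>t\<bar> * \<bar>t\<bar>" "g \<bar>t\<bar> * \<bar>t\<bar> \<le> q * young_primitive g \<bar>t\<bar>" for t
    using G1[of "\<bar>t\<bar>"] young_primitive_pos[OF g, of "\<bar>t\<bar>"]
    by (cases "t = 0"; simp add: young_primitive_nonpos field_simps)+
  have G: "(\<lambda>x. young_primitive g \<bar>f x\<bar>) \<in> borel_measurable M"
    by (rule borel_measurable_young_primitive_abs[OF g f])
  have intG: "integrable M (\<lambda>x. young_primitive g \<bar>f x\<bar>)"
    using G fin young_primitive_nonneg[OF g] by (intro integrableI_nonneg) auto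
  have int_eq: "(\<integral>x. young_primitive g \<bar>f x\<bar> \<partial>M) = c"
    using G fin young_primitive_nonneg[OF g] by (subst integral_eq_nn_integral) auto
  have "(\<lambda>x. g \<bar>f x\<bar>) \<in> borel_measurable M"
    using measurable_compose[OF f borel_measurable_young_density_abs[OF g]] .
  then have meas: "(\<lambda>x. g \<bar>f x\<bar> * \<bar>f x\<bar>) \<in> borel_measurable M"
    using f by auto
  have int: "integrable M (\<lambda>x. g \<bar>f x\<bar> * \<bar>f x\<bar>)"
  proof (rule Bochner_Integration.integrable_bound[OF integrable_mult_right[OF intG, of q] meas])
    show "AE x in M. norm (g \<bar>f x\<bar> * \<bar>f x\<bar>) \<le> norm (q * young_primitive g \<bar>f x\<bar>)"
      using le(2) young_density_nonneg[OF g] by (auto intro: order_trans[OF _ abs_ge_self])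
  qed
  have "(\<integral>x. p * young_primitive g \<bar>f x\<bar> \<partial>M) \<le> (\<integral>x. g \<bar>f x\<bar> * \<bar>f x\<bar> \<partial>M)"
    by (rule integral_mono[OF integrable_mult_right[OF intG] int le(1)])
  moreover have "(\<integral>x. g \<bar>f x\<bar> * \<bar>f x\<bar> \<partial>M) \<le> (\<integral>x. q * young_primitive g \<bar>f x\<bar> \<partial>M)"
    by (rule integral_mono[OF int integrable_mult_right[OF intG] le(2)])
  ultimately show "p * c \<le> (\<integral>x. signed_g g (f x) * f x \<partial>M)" "(\<integral>x. signed_g g (f x) * f x \<partial>M) \<le> q * c"
    by (simp_all add: eq int_eq)
qed

text \<open>Testing with v = u gives p J(u) \<le> lam R, where R, the right-hand integral, lies
  between p \<alpha> and q \<alpha> by (G_1); the lower bound makes R positive, so that it can be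
  divided out.\<close>

lemma dirichlet_eigenvalue_ge:
  fixes u :: "'a::euclidean_space \<Rightarrow> real"
  assumes g: "young_density g"
    and G1: "0 < p" "\<And>t. 0 < t \<Longrightarrow> p \<le> t * g t / young_primitive g t \<and> t * g t / young_primitive g t \<le> q"
    and \<Omega>: "\<Omega> \<in> sets borel" and "0 < \<alpha>"
    and u: "dirichlet_eigenpair g s \<Omega> lam u" "modular_I g \<Omega> u = ennreal \<alpha>"
    and B: "0 \<le> B" "ennreal B \<le> modular_J g s u"
  shows "p * B / (q * \<alpha>) \<le> lam"
proof -
  have W0: "u \<in> W0 g s \<Omega>"
    using u(1) by (simp add: dirichlet_eigenpair_def)
  define c where "c = enn2real (modular_J g s u)"
  have c: "0 \<le> c" "modular_J g s u = ennreal c"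
    using W0_D(3)[OF W0] by (auto simp: c_def less_top)
  have "B \<le> c"
    using B c by simp
  define R where "R = (LINT x:\<Omega>|lebesgue. signed_g g (u x) * u x)"
  have "p * c \<le> (LINT z|mu. signed_g g (Ds s u z) * Ds s u z)"
    using c by (intro young_density_integral_bounds(1)[OF g G1(2) borel_measurable_Ds_mu[OF W0_D(1)[OF W0]]])
      (simp_all add: modular_J_def)
  also have "\<dots> = lam * R"
    using u(1) W0 by (auto simp: dirichlet_eigenpair_def R_def)
  finally have main: "p * c \<le> lam * R" .
  \<comment> \<open>Cutting off outside \<Omega> turns integrals over \<Omega> into integrals over
    the whole space.\<close>
  define v where "v x = indicator \<Omega> x * u x" for x
  have v: "v \<in> borel_measurable lebesgue"
    unfolding v_def using W0_D(1)[OF W0] \<Omega> by (intro borel_measurable_times borel_measurable_indicator) auto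
  have "ennreal (young_primitive g \<bar>v x\<bar>) = ennreal (young_primitive g \<bar>u x\<bar>) * indicator \<Omega> x" for x
    by (auto simp: v_def indicator_def young_primitive_nonpos)
  then have "(\<integral>\<^sup>+x. ennreal (young_primitive g \<bar>v x\<bar>) \<partial>lebesgue) = ennreal \<alpha>"
    using u(2) by (simp add: modular_I_def)
  moreover have "(\<integral>x. signed_g g (v x) * v x \<partial>lebesgue) = R"
    unfolding R_def set_lebesgue_integral_def
    by (intro Bochner_Integration.integral_cong) (auto simp: v_def indicator_def)
  ultimately have R: "p * \<alpha> \<le> R" "R \<le> q * \<alpha>"
    using young_density_integral_bounds[OF g G1(2) v] \<open>0 < \<alpha>\<close> by auto
  have "0 < R"
    using R(1) \<open>0 < p\<close> \<open>0 < \<alpha>\<close> by (meson less_le_trans mult_pos_pos)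
  have "p * B / (q * \<alpha>) \<le> p * c / R"
    using R(2) \<open>0 < R\<close> \<open>B \<le> c\<close> \<open>0 < p\<close> B(1) by (intro frac_le mult_left_mono mult_nonneg_nonneg) auto
  also have "\<dots> \<le> lam"
    using main \<open>0 < R\<close> by (simp add: field_simps)
  finally show ?thesis .
qed

theorem theorem1p3:
  fixes \<Omega> :: "(real ^ 'n) set"
    and s \<alpha> :: real
    and g :: "real \<Rightarrow> real"
    and \<Lambda> :: "nat \<Rightarrow> real"
  assumes "open \<Omega>" and "bounded \<Omega>"
    and "0 < s" and "s < 1"
    and "young_density g"
    and "cond_G1 g" and "cond_G2 g" and "cond_G3 CARD('n) s g"
    and "\<alpha> > 0"
    and "minimax_eigenvalues g s \<Omega> \<alpha> \<Lambda>"
  shows "filterlim \<Lambda> at_top sequentially \<and>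
    (\<lambda>k. C_D g s \<Omega> \<alpha> k) \<longlonglongrightarrow> \<infinity>"
proof
  have C: "eventually (\<lambda>k. ennreal B \<le> C_D g s \<Omega> \<alpha> k) sequentially" for B
    by (rule C_D_eventually_ge) fact+
  show "(\<lambda>k. C_D g s \<Omega> \<alpha> k) \<longlonglongrightarrow> \<infinity>"
  proof (rule order_tendstoI)
    fix a :: ennreal assume "a < \<infinity>"
    then obtain r where "a = ennreal r" "0 \<le> r"
      by (cases a) auto
    then have "a < ennreal (r + 1)"
      by (simp add: ennreal_lessI)
    then show "eventually (\<lambda>k. a < C_D g s \<Omega> \<alpha> k) sequentially"
      using C[of "r + 1"] by (auto elim!: eventually_mono intro: less_le_trans)
  qed simp
  obtain p q where pq: "1 < p"
    "\<And>t. 0 < t \<Longrightarrow> p \<le> t * g t / young_primitive g t \<and> t * g t / young_primitive g t \<le> q"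
    using \<open>cond_G1 g\<close> unfolding cond_G1_def by blast
  have "p \<le> q"
    using pq(2)[of 1] by linarith
  show "filterlim \<Lambda> at_top sequentially"
    unfolding filterlim_at_top
  proof
    fix Z :: real
    \<comment> \<open>Chosen so that p B / (q \<alpha>) \<ge> Z; the maximum keeps it non-negative,
      as the eigenvalue bound demands.\<close>
    define B where "B = max 0 (Z * (q * \<alpha>) / p)"
    have B: "Z \<le> p * B / (q * \<alpha>)"
    proof -
      have "Z * (q * \<alpha>) / p \<le> B"
        by (simp add: B_def)
      then show ?thesis
        using pq(1) \<open>p \<le> q\<close> \<open>\<alpha> > 0\<close> by (simp add: field_simps)
    qed
    show "eventually (\<lambda>k. Z \<le> \<Lambda> k) sequentially"
      \<comment> \<open>Eigenfunctions are provided for k \<ge> 1 only.\<close>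
      using C[of B] eventually_ge_at_top[of 1]
    proof eventually_elim
      case (elim k)
      obtain u where u: "dirichlet_eigenpair g s \<Omega> (\<Lambda> k) u" "modular_I g \<Omega> u = ennreal \<alpha>"
        "modular_J g s u = C_D g s \<Omega> \<alpha> k"
        using \<open>minimax_eigenvalues g s \<Omega> \<alpha> \<Lambda>\<close> elim(2) unfolding minimax_eigenvalues_def by blast
      have "p * B / (q * \<alpha>) \<le> \<Lambda> k"
        using elim(1) u pq \<open>open \<Omega>\<close> \<open>\<alpha> > 0\<close> \<open>young_density g\<close>
        by (intro dirichlet_eigenvalue_ge[of g p q \<Omega> \<alpha> s "\<Lambda> k" u B]) (auto simp: B_def)
      with B show ?case
        by linarith
    qed
  qed
qed

end
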